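(* Let $d_{w,1}$ be a Lorentz sequence space (with $p=1$). Let $T\in L(d_{w,1})$ be strictly singular and suppose $T=AB$ where $A\in L(\ell_1,d_{w,1})$ and $B\in L(d_{w,1},\ell_1)$ are both positive operators. Then $T\in\overline{J^j}$.
   Context: Let $w=(w_n)$ be a real sequence with $w_1=1$, $w_n\downarrow 0$ and $\sum_n w_n=\infty$. The Lorentz sequence space $d_{w,1}$ is the Banach space of all $x=(x_n)\in c_0$ with $\|x\|=\sum_{n}w_n x^*_n<\infty$, where $(x^*_n)$ is the non-increasing rearrangement of $(|x_n|)$. Both $\ell_1$ and $d_{w,1}$ are ordered coordinate-wise ($x\ge 0$ iff all coordinates are $\ge 0$); an operator is positive if it maps nonnegative vectors to nonnegative vectors. The formal identity $j\colon\ell_1\to d_{w,1}$ sends the $n$-th unit vector of $\ell_1$ to that of $d_{w,1}$. $J^j$ is the set of $S\in L(d_{w,1})$ of the form $S=CjD$ with $C\in L(d_{w,1})$, $D\in L(d_{w,1},\ell_1)$, and $\overline{J^j}$ its norm closure. An operator is strictly singular if its restriction to no infinite-dimensional closed subspace is an isomorphism. *)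

theory Defs
  imports "HOL-Analysis.Analysis"
begin

text \<open>Sequences are functions nat => real; index n here corresponds to n+1 in the paper.\<close>

definition weight :: "(nat \<Rightarrow> real) \<Rightarrow> bool" where
  "weight w \<longleftrightarrow> w 0 = 1 \<and> antimono w \<and> w \<longlonglongrightarrow> 0 \<and> \<not> summable w"

text \<open>Non-increasing rearrangement of (|x n|) (for x in c0):
  the n-th value is the least s \<ge> 0 with at most n indices k having |x k| > s.\<close>
definition drearr :: "(nat \<Rightarrow> real) \<Rightarrow> nat \<Rightarrow> real" where
  "drearr x n = Inf {s. 0 \<le> s \<and> finite {k. s < \<bar>x k\<bar>} \<and> card {k. s < \<bar>x k\<bar>} \<le> n}"

definition lorentz_norm :: "(nat \<Rightarrow> real) \<Rightarrow> (nat \<Rightarrow> real) \<Rightarrow> real" where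
  "lorentz_norm w x = (\<Sum>n. w n * drearr x n)"

definition dw1 :: "(nat \<Rightarrow> real) \<Rightarrow> (nat \<Rightarrow> real) set" where
  "dw1 w = {x. x \<longlonglongrightarrow> 0 \<and> summable (\<lambda>n. w n * drearr x n)}"

definition l1 :: "(nat \<Rightarrow> real) set" where
  "l1 = {x. summable (\<lambda>n. \<bar>x n\<bar>)}"

definition l1_norm :: "(nat \<Rightarrow> real) \<Rightarrow> real" where
  "l1_norm x = (\<Sum>n. \<bar>x n\<bar>)"

definition bounded_op ::
  "(nat \<Rightarrow> real) set \<Rightarrow> ((nat \<Rightarrow> real) \<Rightarrow> real) \<Rightarrow> (nat \<Rightarrow> real) set \<Rightarrow> ((nat \<Rightarrow> real) \<Rightarrow> real)
   \<Rightarrow> ((nat \<Rightarrow> real) \<Rightarrow> (nat \<Rightarrow> real)) \<Rightarrow> bool" where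
  "bounded_op X nX Y nY T \<longleftrightarrow>
     (\<forall>x\<in>X. T x \<in> Y) \<and>
     (\<forall>x\<in>X. \<forall>y\<in>X. T (\<lambda>n. x n + y n) = (\<lambda>n. T x n + T y n)) \<and>
     (\<forall>c. \<forall>x\<in>X. T (\<lambda>n. c * x n) = (\<lambda>n. c * T x n)) \<and>
     (\<exists>C. \<forall>x\<in>X. nY (T x) \<le> C * nX x)"

definition positive_op :: "(nat \<Rightarrow> real) set \<Rightarrow> ((nat \<Rightarrow> real) \<Rightarrow> (nat \<Rightarrow> real)) \<Rightarrow> bool" where
  "positive_op X T \<longleftrightarrow> (\<forall>x\<in>X. (\<forall>n. 0 \<le> x n) \<longrightarrow> (\<forall>n. 0 \<le> T x n))"

definition lin_subspace :: "(nat \<Rightarrow> real) set \<Rightarrow> bool" where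
  "lin_subspace M \<longleftrightarrow> (\<lambda>n. 0) \<in> M \<and>
     (\<forall>x\<in>M. \<forall>y\<in>M. (\<lambda>n. x n + y n) \<in> M) \<and> (\<forall>c. \<forall>x\<in>M. (\<lambda>n. c * x n) \<in> M)"

definition infinite_dim :: "(nat \<Rightarrow> real) set \<Rightarrow> bool" where
  "infinite_dim M \<longleftrightarrow> \<not> (\<exists>B. finite B \<and> B \<subseteq> M \<and>
      (\<forall>x\<in>M. \<exists>c. x = (\<lambda>n. \<Sum>b\<in>B. c b * b n)))"

definition norm_closed :: "(nat \<Rightarrow> real) set \<Rightarrow> ((nat \<Rightarrow> real) \<Rightarrow> real) \<Rightarrow> (nat \<Rightarrow> real) set \<Rightarrow> bool" where
  "norm_closed X nX M \<longleftrightarrow> (\<forall>f x. (\<forall>k. f k \<in> M) \<and> x \<in> X \<and>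
      (\<lambda>k. nX (\<lambda>n. f k n - x n)) \<longlonglongrightarrow> 0 \<longrightarrow> x \<in> M)"

text \<open>Strictly singular: no infinite-dimensional closed subspace on which T is an
  isomorphism (onto its image), i.e. bounded below.\<close>
definition strictly_singular ::
  "(nat \<Rightarrow> real) set \<Rightarrow> ((nat \<Rightarrow> real) \<Rightarrow> real) \<Rightarrow> ((nat \<Rightarrow> real) \<Rightarrow> real)
   \<Rightarrow> ((nat \<Rightarrow> real) \<Rightarrow> (nat \<Rightarrow> real)) \<Rightarrow> bool" where
  "strictly_singular X nX nY T \<longleftrightarrow> \<not> (\<exists>M. M \<subseteq> X \<and> lin_subspace M \<and> infinite_dim M \<and>
      norm_closed X nX M \<and> (\<exists>c>0. \<forall>x\<in>M. c * nX x \<le> nY (T x)))"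

text \<open>Formal identity l1 -> d_{w,1}.\<close>
definition jid :: "(nat \<Rightarrow> real) \<Rightarrow> (nat \<Rightarrow> real)" where
  "jid y = y"

definition in_Jj :: "(nat \<Rightarrow> real) \<Rightarrow> ((nat \<Rightarrow> real) \<Rightarrow> (nat \<Rightarrow> real)) \<Rightarrow> bool" where
  "in_Jj w S \<longleftrightarrow> (\<exists>C D. bounded_op (dw1 w) (lorentz_norm w) (dw1 w) (lorentz_norm w) C \<and>
      bounded_op (dw1 w) (lorentz_norm w) l1 l1_norm D \<and>
      (\<forall>x\<in>dw1 w. S x = C (jid (D x))))"

definition in_closure_Jj :: "(nat \<Rightarrow> real) \<Rightarrow> ((nat \<Rightarrow> real) \<Rightarrow> (nat \<Rightarrow> real)) \<Rightarrow> bool" where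
  "in_closure_Jj w T \<longleftrightarrow> (\<forall>\<epsilon>>0. \<exists>S. in_Jj w S \<and>
      (\<forall>x\<in>dw1 w. lorentz_norm w (\<lambda>n. T x n - S x n) \<le> \<epsilon> * lorentz_norm w x))"

end

theory Submission
  imports Defs "HOL-Library.Function_Algebras" "HOL-Complex_Analysis.Great_Picard"
begin

text \<open>Split the matrix of \<open>A\<close> at a threshold \<open>\<tau>\<close>. Each column has boundedly many
  entries \<open>\<ge> \<tau>\<close>, so the large part of \<open>A\<close> maps \<open>l1\<close> into \<open>l1\<close> and its composition with \<open>B\<close>
  lies in the ideal. If the small parts composed with \<open>B\<close> did not tend to zero in norm, positivity
  would give \<open>x m \<ge> 0\<close> in the unit ball and flat vectors \<open>y m \<le> T (x m)\<close> whose norms stay away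
  from zero while their suprema tend to zero. Along a coordinatewise convergent subsequence of
  \<open>T (x m)\<close>, suitable differences of the \<open>x m\<close> have images that dominate flat vectors on
  successive disjoint blocks; those blocks span a copy of \<open>l1\<close>, so \<open>T\<close> is bounded below on the
  closed span of the differences and is not strictly singular.\<close>

text \<open>A lower l1 estimate needs one injective assignment of weights that serves all blocks at
  once, and a later block could lose its norm if it depended on weights already spent. Flatness
  rules this out: when all coordinates are at most \<open>\<tau>\<close>, the pairs using one of the
  first \<open>N\<close> coordinates or of the first \<open>N\<close> weights contribute at most
  \<open>2 * N * \<tau>\<close>, so nearly the whole norm is still visible with fresh weights. The
  images \<open>T (x m)\<close> may share a large common part; differences along the subsequence
  cancel it on any initial segment, and only coordinatewise convergence is used for this. Positivity
  excludes cancellation between the two parts of the matrix: both have nonnegative entries, so for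
  \<open>x \<ge> 0\<close> the small part is dominated by \<open>T x\<close>. Flatness comes from
  \<open>B\<close>: entries of size at most \<open>\<tau>\<close> are summed against nonnegative
  coefficients of total mass at most \<open>\<beta>\<close>, a bound for the norm of
  \<open>B\<close>, which gives coordinates of size at most \<open>\<beta> * \<tau>\<close>.\<close>

section \<open>The non-increasing rearrangement\<close>

lemma finite_large_coords:
  fixes x :: "nat \<Rightarrow> real"
  assumes "x \<longlonglongrightarrow> 0" "0 < s"
  shows "finite {k. s \<le> \<bar>x k\<bar>}"
proof -
  obtain K where K: "\<And>k. k \<ge> K \<Longrightarrow> \<bar>x k\<bar> < s"
    using LIMSEQ_D[OF assms] by auto
  have "{k. s \<le> \<bar>x k\<bar>} \<subseteq> {..<K}"
    using K by (force simp: not_less[symmetric])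
  then show ?thesis using finite_subset by blast
qed

lemma drearr_set_bdd_below:
  "bdd_below {s. 0 \<le> s \<and> finite {k. s < \<bar>x k\<bar>} \<and> card {k. s < \<bar>x k\<bar>} \<le> n}"
  by (rule bdd_belowI[of _ 0]) auto

lemma drearr_set_nonempty:
  fixes x :: "nat \<Rightarrow> real"
  assumes "x \<longlonglongrightarrow> 0"
  shows "{s. 0 \<le> s \<and> finite {k. s < \<bar>x k\<bar>} \<and> card {k. s < \<bar>x k\<bar>} \<le> n} \<noteq> {}"
proof -
  have "Bseq x" using assms convergent_def convergent_imp_Bseq by blast
  then obtain K where K: "K > 0" "\<And>n. \<bar>x n\<bar> \<le> K" by (auto simp: Bseq_def)
  then have "{k. K < \<bar>x k\<bar>} = {}" by (auto simp: not_less)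
  then show ?thesis using K(1) by (auto intro!: exI[of _ K])
qed

lemma drearr_le:
  assumes "0 \<le> s" "finite {k. s < \<bar>x k\<bar>}" "card {k. s < \<bar>x k\<bar>} \<le> n"
  shows "drearr x n \<le> s"
  unfolding drearr_def by (rule cInf_lower[OF _ drearr_set_bdd_below]) (use assms in auto)

lemma drearr_ge:
  assumes "x \<longlonglongrightarrow> 0" "finite G" "n < card G" "\<And>k. k \<in> G \<Longrightarrow> s \<le> \<bar>x k\<bar>"
  shows "s \<le> drearr x n"
  unfolding drearr_def
proof (rule cInf_greatest[OF drearr_set_nonempty[OF assms(1)]])
  fix t assume t: "t \<in> {s. 0 \<le> s \<and> finite {k. s < \<bar>x k\<bar>} \<and> card {k. s < \<bar>x k\<bar>} \<le> n}"
  show "s \<le> t"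
  proof (rule ccontr)
    assume "\<not> s \<le> t"
    then have "G \<subseteq> {k. t < \<bar>x k\<bar>}" using assms(4) by force
    then have "card G \<le> card {k. t < \<bar>x k\<bar>}" using t by (intro card_mono) auto
    then show False using t assms(3) by auto
  qed
qed

lemma drearr_nonneg: "x \<longlonglongrightarrow> 0 \<Longrightarrow> 0 \<le> drearr x n"
  unfolding drearr_def by (rule cInf_greatest[OF drearr_set_nonempty]) auto

lemma drearr_antimono: "x \<longlonglongrightarrow> 0 \<Longrightarrow> m \<le> n \<Longrightarrow> drearr x n \<le> drearr x m"
  unfolding drearr_def
  by (rule cInf_superset_mono[OF drearr_set_nonempty drearr_set_bdd_below]) auto

lemma drearr_mono:
  assumes "y \<longlonglongrightarrow> 0" "\<And>k. \<bar>x k\<bar> \<le> \<bar>y k\<bar>"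
  shows "drearr x n \<le> drearr y n"
  unfolding drearr_def
proof (rule cInf_superset_mono[OF drearr_set_nonempty[OF assms(1)] drearr_set_bdd_below])
  show "{s. 0 \<le> s \<and> finite {k. s < \<bar>y k\<bar>} \<and> card {k. s < \<bar>y k\<bar>} \<le> n}
    \<subseteq> {s. 0 \<le> s \<and> finite {k. s < \<bar>x k\<bar>} \<and> card {k. s < \<bar>x k\<bar>} \<le> n}"
  proof clarsimp
    fix s assume s: "0 \<le> s" "finite {k. s < \<bar>y k\<bar>}" "card {k. s < \<bar>y k\<bar>} \<le> n"
    have sub: "{k. s < \<bar>x k\<bar>} \<subseteq> {k. s < \<bar>y k\<bar>}" using assms(2) less_le_trans by blast
    show "finite {k. s < \<bar>x k\<bar>} \<and> card {k. s < \<bar>x k\<bar>} \<le> n"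
      using finite_subset[OF sub s(2)] card_mono[OF s(2) sub] s(3) by auto
  qed
qed

text \<open>Only finitely many coordinates reach half of \<open>drearr x n\<close>. If all
  coordinates outside \<open>G\<close> were strictly below \<open>drearr x n\<close>, some smaller
  level would be exceeded only on \<open>G\<close>, hence at most \<open>n\<close> times,
  contradicting the infimum.\<close>

lemma drearr_attained:
  fixes x :: "nat \<Rightarrow> real"
  assumes "x \<longlonglongrightarrow> 0" "finite G" "card G \<le> n"
  shows "\<exists>i. i \<notin> G \<and> drearr x n \<le> \<bar>x i\<bar>"
proof (rule ccontr)
  assume "\<not> ?thesis"
  then have less: "\<And>i. i \<notin> G \<Longrightarrow> \<bar>x i\<bar> < drearr x n" by (auto simp: not_le)
  have "\<exists>i. i \<notin> G" using assms(2) ex_new_if_finite infinite_UNIV_nat by blast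
  then have pos: "0 < drearr x n" using less by (metis abs_ge_zero le_less_trans)
  define L where "L = {k. drearr x n / 2 \<le> \<bar>x k\<bar>} - G"
  have finL: "finite L" unfolding L_def by (intro finite_Diff finite_large_coords assms) (use pos in simp)
  \<comment> \<open>The default value \<open>drearr x n / 2\<close> keeps the set nonempty and also
    bounds the coordinates that lie neither in \<open>G\<close> nor in \<open>L\<close>.\<close>
  define s where "s = Max (insert (drearr x n / 2) ((\<lambda>k. \<bar>x k\<bar>) ` L))"
  have s_less: "s < drearr x n"
    unfolding s_def using finL pos less by (subst Max_less_iff) (auto simp: L_def)
  have s_ge: "drearr x n / 2 \<le> s" unfolding s_def using finL by (intro Max_ge) auto
  have sL: "\<bar>x k\<bar> \<le> s" if "k \<in> L" for k unfolding s_def using finL that by (intro Max_ge) auto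
  have "{k. s < \<bar>x k\<bar>} \<subseteq> G"
    using s_ge sL unfolding L_def by force
  then have "finite {k. s < \<bar>x k\<bar>}" "card {k. s < \<bar>x k\<bar>} \<le> n"
    using assms finite_subset card_mono by (blast, meson card_mono le_trans)
  then have "drearr x n \<le> s" using drearr_le s_ge pos by auto
  then show False using s_less by simp
qed

text \<open>Greedy choice: at stage \<open>m\<close> at most \<open>m\<close> indices are taken, so
  \<open>drearr_attained\<close> supplies a new one. The inequality suffices, since it is used only
  to bound partial sums of the norm from above.\<close>

lemma drearr_enumeration:
  fixes x :: "nat \<Rightarrow> real"
  assumes "x \<longlonglongrightarrow> 0"
  shows "\<exists>f. inj_on f {..<m} \<and> (\<forall>n<m. drearr x n \<le> \<bar>x (f n)\<bar>)"
proof (induction m)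
  case 0 show ?case by simp
next
  case (Suc m)
  then obtain f where f: "inj_on f {..<m}" "\<And>n. n < m \<Longrightarrow> drearr x n \<le> \<bar>x (f n)\<bar>" by blast
  obtain i where i: "i \<notin> f ` {..<m}" "drearr x m \<le> \<bar>x i\<bar>"
    using drearr_attained[OF assms, of "f ` {..<m}" m] card_image_le[of "{..<m}" f] by auto
  have "inj_on (f(m := i)) {..<Suc m}"
    using f(1) i(1) by (auto simp: inj_on_def lessThan_Suc)
  moreover have "\<forall>n<Suc m. drearr x n \<le> \<bar>x ((f(m := i)) n)\<bar>"
    using f(2) i(2) by (auto simp: less_Suc_eq)
  ultimately show ?case by blast
qed

section \<open>The Lorentz norm\<close>

text \<open>Finite partial injections, as sets of pairs (coordinate, weight index): the Lorentz norm is
  the supremum of the weighted sums over them.\<close>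

definition pinj :: "(nat \<times> nat) set \<Rightarrow> bool" where
  "pinj P \<longleftrightarrow> finite P \<and> inj_on fst P \<and> inj_on snd P"

definition psum :: "(nat \<Rightarrow> real) \<Rightarrow> (nat \<times> nat) set \<Rightarrow> (nat \<Rightarrow> real) \<Rightarrow> real" where
  "psum w P x = (\<Sum>p\<in>P. w (snd p) * \<bar>x (fst p)\<bar>)"

text \<open>Induction that adds the largest element \<open>b\<close>: it exceeds all of
  \<open>J\<close>, so \<open>card J \<le> b\<close> and its weight is at most
  \<open>w (card J)\<close>.\<close>

lemma sum_antimono_le_initial:
  fixes w :: "nat \<Rightarrow> real"
  assumes "antimono w" "finite J"
  shows "sum w J \<le> sum w {..<card J}"
  using assms(2)
proof (induction J rule: finite_linorder_max_induct)
  case empty show ?case by simp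
next
  case (insert b J)
  have "J \<subseteq> {..<b}" using insert by auto
  then have "card J \<le> b" by (metis card_lessThan card_mono finite_lessThan)
  then have "w b \<le> w (card J)" using assms(1) by (auto dest: antimonoD)
  moreover have "b \<notin> J" using insert by auto
  ultimately show ?case using insert by simp
qed

text \<open>Summation by parts. The induction carries the stronger bound
  \<open>a l * sum d {..<l}\<close>, which survives each step because \<open>a\<close> decreases
  while the partial sums of \<open>d\<close> stay nonnegative.\<close>

lemma Abel_sum_nonneg:
  fixes a d :: "nat \<Rightarrow> real"
  assumes "\<And>m n. m \<le> n \<Longrightarrow> a n \<le> a m" "\<And>n. 0 \<le> a n"
    and "\<And>l. l \<le> m \<Longrightarrow> 0 \<le> sum d {..<l}"
  shows "0 \<le> (\<Sum>n<m. d n * a n)"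
proof -
  have "a l * sum d {..<l} \<le> (\<Sum>n<l. d n * a n)" if "l \<le> m" for l
    using that
  proof (induction l)
    case (Suc l)
    have "a (Suc l) * sum d {..<Suc l} \<le> a l * sum d {..<Suc l}"
      using assms(1)[of l "Suc l"] assms(3)[OF Suc.prems] by (intro mult_right_mono) auto
    also have "\<dots> = a l * sum d {..<l} + d l * a l" by (simp add: algebra_simps)
    also have "\<dots> \<le> (\<Sum>n<Suc l. d n * a n)" using Suc by simp
    finally show ?case .
  qed simp
  from this[of m] assms(2)[of m] assms(3)[of m] show ?thesis
    by (meson le_trans mult_nonneg_nonneg order_refl order_trans)
qed

locale lorentz_weight =
  fixes w :: "nat \<Rightarrow> real"
  assumes weight: "weight w"
begin

lemma w_antimono: "antimono w" and w_tendsto: "w \<longlonglongrightarrow> 0" and w0: "w 0 = 1"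
  and w_not_summable: "\<not> summable w"
  using weight by (auto simp: weight_def)

lemma w_nonneg: "0 \<le> w n"
  using decseq_ge[OF w_antimono w_tendsto] by simp

lemma w_le_1: "w n \<le> 1"
  using antimonoD[OF w_antimono, of 0 n] w0 by simp

lemma dw1_tendsto: "x \<in> dw1 w \<Longrightarrow> x \<longlonglongrightarrow> 0"
  by (simp add: dw1_def)

text \<open>One half of the supremum formula, a rearrangement inequality: list the pairs by
  decreasing coordinates, compare the coordinates with \<open>drearr x\<close>, then the weights
  with the initial ones.\<close>

lemma psum_le_lorentz:
  assumes x: "x \<in> dw1 w" and P: "pinj P"
  shows "psum w P x \<le> lorentz_norm w x"
proof -
  note x0 = dw1_tendsto[OF x]
  define zs where "zs = sort_key (\<lambda>p. - \<bar>x (fst p)\<bar>) (SOME zs. set zs = P \<and> distinct zs)"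
  have "\<exists>zs. set zs = P \<and> distinct zs"
    using P finite_distinct_list by (auto simp: pinj_def)
  then have zs: "set zs = P" "distinct zs"
    unfolding zs_def by (metis (mono_tags, lifting) someI_ex set_sort distinct_sort)+
  have sorted: "sorted (map (\<lambda>p. - \<bar>x (fst p)\<bar>) zs)"
    unfolding zs_def by (rule sorted_sort_key)
  define m where "m = length zs"
  define u where "u n = w (snd (zs ! n))" for n
  have bij: "bij_betw ((!) zs) {..<m} P"
    using zs bij_betw_nth[of zs "{..<m}" P] unfolding m_def by auto
  \<comment> \<open>The pair at position \<open>n\<close> and its \<open>n\<close> predecessors give
    \<open>n + 1\<close> distinct coordinates of at least this size, just enough for
    \<open>drearr_ge\<close>.\<close>
  have coord: "\<bar>x (fst (zs ! n))\<bar> \<le> drearr x n" if n: "n < m" for n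
  proof (rule drearr_ge[OF x0, of "fst ` set (take (Suc n) zs)"])
    have "inj_on fst (set (take (Suc n) zs))"
      using P zs(1) set_take_subset[of "Suc n" zs] by (auto simp: pinj_def intro: inj_on_subset)
    then show "n < card (fst ` set (take (Suc n) zs))"
      using zs(2) n by (simp add: card_image distinct_card m_def)
    fix k assume "k \<in> fst ` set (take (Suc n) zs)"
    then obtain l where l: "l \<le> n" "k = fst (zs ! l)"
      using n unfolding m_def by (fastforce simp: in_set_conv_nth less_Suc_eq_le)
    show "\<bar>x (fst (zs ! n))\<bar> \<le> \<bar>x k\<bar>"
      using sorted_nth_mono[OF sorted, of l n] l n by (simp add: m_def)
  qed auto
  have "psum w P x = (\<Sum>n<m. u n * \<bar>x (fst (zs ! n))\<bar>)"
    unfolding psum_def u_def by (rule sum.reindex_bij_betw[OF bij, symmetric])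
  also have "\<dots> \<le> (\<Sum>n<m. u n * drearr x n)"
    using coord w_nonneg by (intro sum_mono mult_left_mono) (auto simp: u_def)
  also have "\<dots> \<le> (\<Sum>n<m. w n * drearr x n)"
  proof -
    \<comment> \<open>The \<open>u n\<close> are weights at distinct indices, so their partial sums
      never exceed those of \<open>w\<close>; Abel summation with \<open>d = w - u\<close>
      applies.\<close>
    have "0 \<le> (\<Sum>n<m. (w n - u n) * drearr x n)"
    proof (rule Abel_sum_nonneg[OF drearr_antimono[OF x0] drearr_nonneg[OF x0]])
      fix l assume l: "l \<le> m"
      have inj: "inj_on (\<lambda>n. snd (zs ! n)) {..<l}"
      proof -
        have "inj_on (snd \<circ> (!) zs) {..<m}"
          using P bij by (intro comp_inj_on) (auto simp: pinj_def bij_betw_def)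
        then show ?thesis using l by (auto simp: inj_on_def)
      qed
      have "sum u {..<l} = sum w ((\<lambda>n. snd (zs ! n)) ` {..<l})"
        unfolding u_def using inj by (simp add: sum.reindex)
      also have "\<dots> \<le> sum w {..<card ((\<lambda>n. snd (zs ! n)) ` {..<l})}"
        by (rule sum_antimono_le_initial[OF w_antimono]) simp
      also have "\<dots> = sum w {..<l}" using inj by (simp add: card_image)
      finally show "0 \<le> (\<Sum>n<l. w n - u n)" by (simp add: sum_subtractf)
    qed
    then show ?thesis by (simp add: left_diff_distrib sum_subtractf)
  qed
  also have "\<dots> \<le> lorentz_norm w x"
    unfolding lorentz_norm_def using x w_nonneg drearr_nonneg[OF x0]
    by (intro sum_le_suminf) (auto simp: dw1_def)
  finally show ?thesis .
qed

text \<open>The other half of the supremum formula. It yields membership together with the bound, so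
  the triangle inequality, monotonicity and scaling reduce to finite sums, and the rearrangement of
  a sum of sequences never has to be analysed.\<close>

lemma lorentz_le:
  assumes x0: "x \<longlonglongrightarrow> 0" and le: "\<And>P. pinj P \<Longrightarrow> psum w P x \<le> M"
  shows "x \<in> dw1 w" "lorentz_norm w x \<le> M"
proof -
  have part: "(\<Sum>n<m. w n * drearr x n) \<le> M" for m
  proof -
    obtain f where f: "inj_on f {..<m}" "\<And>n. n < m \<Longrightarrow> drearr x n \<le> \<bar>x (f n)\<bar>"
      using drearr_enumeration[OF x0] by blast
    let ?P = "(\<lambda>n. (f n, n)) ` {..<m}"
    have "pinj ?P" using f(1) by (auto simp: pinj_def inj_on_def)
    have "(\<Sum>n<m. w n * drearr x n) \<le> (\<Sum>n<m. w n * \<bar>x (f n)\<bar>)"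
      using f w_nonneg by (intro sum_mono mult_left_mono) auto
    also have "\<dots> = psum w ?P x"
      unfolding psum_def by (subst sum.reindex) (auto simp: inj_on_def)
    also have "\<dots> \<le> M" by (rule le) fact
    finally show ?thesis .
  qed
  have "summable (\<lambda>n. w n * drearr x n)"
    using part w_nonneg drearr_nonneg[OF x0] by (intro summableI_nonneg_bounded) auto
  then show "x \<in> dw1 w" "lorentz_norm w x \<le> M"
    using x0 part by (auto simp: dw1_def lorentz_norm_def intro!: suminf_le_const)
qed

end

lemma psum_mono:
  assumes "\<And>n. 0 \<le> w n" "\<And>p. p \<in> P \<Longrightarrow> \<bar>x (fst p)\<bar> \<le> \<bar>y (fst p)\<bar>"
  shows "psum w P x \<le> psum w P y"
  unfolding psum_def using assms by (intro sum_mono mult_left_mono) auto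

lemma psum_add_le:
  assumes "\<And>n. 0 \<le> w n"
  shows "psum w P (\<lambda>n. x n + y n) \<le> psum w P x + psum w P y"
  unfolding psum_def sum.distrib[symmetric] distrib_left[symmetric]
  using assms by (intro sum_mono mult_left_mono) auto

lemma psum_scale: "psum w P (\<lambda>n. c * x n) = \<bar>c\<bar> * psum w P x"
  by (simp add: psum_def abs_mult sum_distrib_left mult_ac)

lemma pinj_subset: "pinj Q \<Longrightarrow> P \<subseteq> Q \<Longrightarrow> pinj P"
  by (auto simp: pinj_def intro: finite_subset inj_on_subset)

definition tail :: "nat \<Rightarrow> (nat \<Rightarrow> real) \<Rightarrow> nat \<Rightarrow> real" where
  "tail N x n = (if n < N then 0 else x n)"

section \<open>Norm properties of the Lorentz space and decay of tails\<close>

context lorentz_weight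
begin

lemma psum_le_sum_coords:
  assumes "pinj P" "fst ` P \<subseteq> {..<N}"
  shows "psum w P x \<le> (\<Sum>i<N. \<bar>x i\<bar>)"
proof -
  have "psum w P x \<le> (\<Sum>p\<in>P. \<bar>x (fst p)\<bar>)"
    unfolding psum_def using w_le_1 w_nonneg by (intro sum_mono mult_left_le_one_le) auto
  also have "\<dots> = (\<Sum>i\<in>fst ` P. \<bar>x i\<bar>)"
    using assms(1) by (simp add: pinj_def sum.reindex)
  also have "\<dots> \<le> (\<Sum>i<N. \<bar>x i\<bar>)" using assms(2) by (intro sum_mono2) auto
  finally show ?thesis .
qed

lemma coord_le_lorentz:
  assumes "x \<in> dw1 w" shows "\<bar>x i\<bar> \<le> lorentz_norm w x"
  using psum_le_lorentz[OF assms, of "{(i, 0)}"] by (simp add: pinj_def psum_def w0)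

lemma lorentz_nonneg: "x \<in> dw1 w \<Longrightarrow> 0 \<le> lorentz_norm w x"
  using coord_le_lorentz[of x 0] by linarith

lemma lorentz_mono:
  assumes y: "y \<in> dw1 w" and le: "\<And>i. \<bar>x i\<bar> \<le> \<bar>y i\<bar>"
  shows "x \<in> dw1 w" "lorentz_norm w x \<le> lorentz_norm w y"
proof -
  have x0: "x \<longlonglongrightarrow> 0"
    by (rule Lim_null_comparison[of _ "\<lambda>i. \<bar>y i\<bar>"])
      (use le dw1_tendsto[OF y] in \<open>auto intro: tendsto_rabs_zero\<close>)
  have *: "psum w P x \<le> lorentz_norm w y" if "pinj P" for P
    using psum_mono[of w P x y, OF w_nonneg le] psum_le_lorentz[OF y that] by linarith
  show "x \<in> dw1 w" "lorentz_norm w x \<le> lorentz_norm w y" using lorentz_le[OF x0 *] by auto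
qed

lemma lorentz_abs:
  assumes "x \<in> dw1 w"
  shows "(\<lambda>i. \<bar>x i\<bar>) \<in> dw1 w" "lorentz_norm w (\<lambda>i. \<bar>x i\<bar>) = lorentz_norm w x"
proof -
  show "(\<lambda>i. \<bar>x i\<bar>) \<in> dw1 w" by (rule lorentz_mono[OF assms]) simp
  show "lorentz_norm w (\<lambda>i. \<bar>x i\<bar>) = lorentz_norm w x"
    by (simp add: lorentz_norm_def drearr_def)
qed

lemma lorentz_add:
  assumes "x \<in> dw1 w" "y \<in> dw1 w"
  shows "(\<lambda>n. x n + y n) \<in> dw1 w"
    "lorentz_norm w (\<lambda>n. x n + y n) \<le> lorentz_norm w x + lorentz_norm w y"
proof -
  have 0: "(\<lambda>n. x n + y n) \<longlonglongrightarrow> 0"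
    using tendsto_add[OF assms[THEN dw1_tendsto]] by simp
  have *: "psum w P (\<lambda>n. x n + y n) \<le> lorentz_norm w x + lorentz_norm w y" if "pinj P" for P
    using psum_add_le[of w P x y, OF w_nonneg] assms[THEN psum_le_lorentz, OF that] by linarith
  show "(\<lambda>n. x n + y n) \<in> dw1 w"
    "lorentz_norm w (\<lambda>n. x n + y n) \<le> lorentz_norm w x + lorentz_norm w y"
    using lorentz_le[OF 0 *] by auto
qed

lemma lorentz_scale_le:
  assumes "x \<in> dw1 w"
  shows "(\<lambda>n. c * x n) \<in> dw1 w" "lorentz_norm w (\<lambda>n. c * x n) \<le> \<bar>c\<bar> * lorentz_norm w x"
proof -
  have 0: "(\<lambda>n. c * x n) \<longlonglongrightarrow> 0"
    using tendsto_mult_left[OF dw1_tendsto[OF assms], of c] by simp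
  have *: "psum w P (\<lambda>n. c * x n) \<le> \<bar>c\<bar> * lorentz_norm w x" if "pinj P" for P
    unfolding psum_scale using psum_le_lorentz[OF assms that] by (intro mult_left_mono) auto
  show "(\<lambda>n. c * x n) \<in> dw1 w" "lorentz_norm w (\<lambda>n. c * x n) \<le> \<bar>c\<bar> * lorentz_norm w x"
    using lorentz_le[OF 0 *] by auto
qed

lemma lorentz_scale:
  assumes "x \<in> dw1 w"
  shows "lorentz_norm w (\<lambda>n. c * x n) = \<bar>c\<bar> * lorentz_norm w x"
proof (cases "c = 0")
  case True
  then show ?thesis
    using lorentz_scale_le[OF assms, of 0] lorentz_nonneg[OF lorentz_scale_le(1)[OF assms, of 0]]
    by simp
next
  case False
  have "lorentz_norm w (\<lambda>n. inverse c * (c * x n)) \<le> \<bar>inverse c\<bar> * lorentz_norm w (\<lambda>n. c * x n)"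
    by (rule lorentz_scale_le(2)[OF lorentz_scale_le(1)[OF assms]])
  moreover have "(\<lambda>n. inverse c * (c * x n)) = x" using False by (auto simp: field_simps)
  ultimately have "lorentz_norm w x \<le> lorentz_norm w (\<lambda>n. c * x n) / \<bar>c\<bar>"
    by (simp add: divide_inverse mult.commute)
  then show ?thesis
    using False lorentz_scale_le(2)[OF assms, of c] by (simp add: field_simps)
qed

lemma lorentz_diff:
  assumes "x \<in> dw1 w" "y \<in> dw1 w"
  shows "(\<lambda>n. x n - y n) \<in> dw1 w"
    "lorentz_norm w (\<lambda>n. x n - y n) \<le> lorentz_norm w x + lorentz_norm w y"
  using lorentz_add[OF assms(1) lorentz_scale_le(1)[OF assms(2), of "-1"]]
    lorentz_scale[OF assms(2), of "-1"] by simp_all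

lemma dw1_zero: "(\<lambda>n. 0) \<in> dw1 w" and lorentz_zero: "lorentz_norm w (\<lambda>n. 0) = 0"
  using lorentz_le[of "\<lambda>n. 0" 0] lorentz_nonneg[of "\<lambda>n. 0"] by (auto simp: psum_def)

lemma dw1_sum: "finite K \<Longrightarrow> (\<And>k. k \<in> K \<Longrightarrow> d k \<in> dw1 w) \<Longrightarrow> (\<lambda>n. \<Sum>k\<in>K. d k n) \<in> dw1 w"
  by (induction K rule: finite_induct) (auto intro: dw1_zero lorentz_add(1))

lemma lorentz_sum_le:
  "finite K \<Longrightarrow> (\<And>k. k \<in> K \<Longrightarrow> d k \<in> dw1 w) \<Longrightarrow>
    lorentz_norm w (\<lambda>n. \<Sum>k\<in>K. d k n) \<le> (\<Sum>k\<in>K. lorentz_norm w (d k))"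
proof (induction K rule: finite_induct)
  case empty show ?case by (simp add: lorentz_zero)
next
  case (insert k K)
  then show ?case
    using lorentz_add(2)[of "d k" "\<lambda>n. \<Sum>k\<in>K. d k n"] dw1_sum[of K d] by simp
qed

lemma l1_subset_dw1:
  assumes "x \<in> l1" shows "x \<in> dw1 w" "lorentz_norm w x \<le> l1_norm x"
proof -
  have sm: "summable (\<lambda>n. \<bar>x n\<bar>)" using assms by (simp add: l1_def)
  then have 0: "x \<longlonglongrightarrow> 0" using summable_LIMSEQ_zero tendsto_rabs_zero_iff by blast
  have *: "psum w P x \<le> l1_norm x" if P: "pinj P" for P
  proof -
    obtain N where "fst ` P \<subseteq> {..<N}"
      using P finite_nat_iff_bounded[of "fst ` P"] by (auto simp: pinj_def)
    from psum_le_sum_coords[OF P this] have "psum w P x \<le> (\<Sum>i<N. \<bar>x i\<bar>)" .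
    also have "\<dots> \<le> l1_norm x"
      unfolding l1_norm_def by (intro sum_le_suminf sm) auto
    finally show ?thesis .
  qed
  show "x \<in> dw1 w" "lorentz_norm w x \<le> l1_norm x" using lorentz_le[OF 0 *] by auto
qed

lemma lorentz_witness:
  assumes "x \<in> dw1 w" "M < lorentz_norm w x"
  shows "\<exists>P. pinj P \<and> M < psum w P x"
  using lorentz_le(2)[OF dw1_tendsto[OF assms(1)], of M] assms(2) by (meson not_le)

lemma tail_le: "\<bar>tail N x i\<bar> \<le> \<bar>x i\<bar>"
  by (simp add: tail_def)

lemma tail_dw1: "x \<in> dw1 w \<Longrightarrow> tail N x \<in> dw1 w"
  by (rule lorentz_mono(1)[OF _ tail_le])

lemma psum_tail_le:
  assumes "x \<in> dw1 w" "pinj P" "fst ` P \<subseteq> {N..}"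
  shows "psum w P x \<le> lorentz_norm w (tail N x)"
proof -
  have "psum w P x = psum w P (tail N x)"
    unfolding psum_def using assms(3) by (intro sum.cong) (auto simp: tail_def not_less)
  then show ?thesis using psum_le_lorentz[OF tail_dw1[OF assms(1)] assms(2)] by simp
qed

text \<open>Split the norm series at \<open>m\<close>. Beyond \<open>m\<close> the rearrangement of
  the tail is dominated by that of \<open>x\<close>; the first \<open>m\<close> terms are small
  because all coordinates of a late tail are.\<close>

lemma tail_small:
  assumes x: "x \<in> dw1 w" and e: "0 < e"
  shows "\<exists>N0. \<forall>N\<ge>N0. lorentz_norm w (tail N x) \<le> e"
proof -
  note x0 = dw1_tendsto[OF x]
  have sm: "summable (\<lambda>n. w n * drearr x n)" using x by (simp add: dw1_def)
  obtain m where m: "\<bar>\<Sum>n. w (n + m) * drearr x (n + m)\<bar> < e / 2"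
    using suminf_exist_split[OF _ sm, of "e/2"] e by auto
  \<comment> \<open>With weights at most 1, the first \<open>m\<close> terms add up to at most
    \<open>m * s \<le> e / 2\<close>; \<open>Suc m\<close> avoids division by zero.\<close>
  define s where "s = e / (2 * real (Suc m))"
  have s: "0 < s" using e by (simp add: s_def)
  obtain N0 where N0: "\<And>k. k \<ge> N0 \<Longrightarrow> \<bar>x k\<bar> < s" using LIMSEQ_D[OF x0 s] by auto
  have "lorentz_norm w (tail N x) \<le> e" if N: "N \<ge> N0" for N
  proof -
    have t: "tail N x \<in> dw1 w" by (rule tail_dw1[OF x])
    then have smt: "summable (\<lambda>n. w n * drearr (tail N x) n)" by (simp add: dw1_def)
    have "\<bar>tail N x k\<bar> \<le> s" for k
      using N0[of k] N s by (auto simp: tail_def)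
    then have "{k. s < \<bar>tail N x k\<bar>} = {}" by (auto simp: not_less)
    then have le_s: "drearr (tail N x) n \<le> s" for n
      using s by (intro drearr_le) auto
    have le_x: "drearr (tail N x) n \<le> drearr x n" for n
      by (rule drearr_mono[OF x0]) (rule tail_le)
    have "lorentz_norm w (tail N x)
      = (\<Sum>n. w (n + m) * drearr (tail N x) (n + m)) + (\<Sum>n<m. w n * drearr (tail N x) n)"
      unfolding lorentz_norm_def by (rule suminf_split_initial_segment[OF smt])
    also have "(\<Sum>n. w (n + m) * drearr (tail N x) (n + m)) \<le> (\<Sum>n. w (n + m) * drearr x (n + m))"
      using summable_ignore_initial_segment[OF sm, of m] summable_ignore_initial_segment[OF smt, of m]
      by (intro suminf_le mult_left_mono le_x w_nonneg) auto
    also have "\<dots> \<le> e / 2" using m by linarith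
    also have "(\<Sum>n<m. w n * drearr (tail N x) n) \<le> (\<Sum>n<m. 1 * s)"
      using le_s w_le_1 w_nonneg drearr_nonneg[OF dw1_tendsto[OF t]]
      by (intro sum_mono mult_mono) auto
    also have "(\<Sum>n<m. 1 * s) \<le> e / 2" using e by (simp add: s_def field_simps)
    finally show ?thesis by simp
  qed
  then show ?thesis by blast
qed

text \<open>Discarding the first \<open>N\<close> weights as well as the first \<open>N\<close> coordinates makes room for
  disjoint blocks that share one injective assignment of weights.\<close>

lemma psum_flat_witness:
  assumes y: "y \<in> dw1 w" and \<delta>: "\<delta> < lorentz_norm w y" and flat: "\<And>i. \<bar>y i\<bar> \<le> \<tau>"
  shows "\<exists>P. pinj P \<and> P \<subseteq> {N..} \<times> {N..} \<and> \<delta> - 2 * real N * \<tau> \<le> psum w P y"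
proof -
  obtain P where P: "pinj P" "\<delta> < psum w P y" using lorentz_witness[OF y \<delta>] by blast
  \<comment> \<open>By injectivity at most \<open>N\<close> pairs have a coordinate below
    \<open>N\<close>, and at most \<open>N\<close> have a weight index below \<open>N\<close>. Each
    pair is worth at most \<open>\<tau>\<close>, so discarding both kinds costs at most
    \<open>2 * N * \<tau>\<close>.\<close>
  define P1 where "P1 = {p \<in> P. fst p < N}"
  define P2 where "P2 = {p \<in> P. snd p < N}"
  define Q where "Q = P - P1 - P2"
  have fin: "finite P" and inj: "inj_on fst P" "inj_on snd P" using P(1) by (auto simp: pinj_def)
  have \<tau>: "0 \<le> \<tau>" using flat[of 0] by linarith
  have small: "psum w R y \<le> real N * \<tau>" if R: "finite R" "card R \<le> N" for R
  proof -
    have "psum w R y \<le> (\<Sum>p\<in>R. 1 * \<tau>)"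
      unfolding psum_def using w_nonneg w_le_1 flat by (intro sum_mono mult_mono) auto
    also have "\<dots> \<le> real N * \<tau>" using R(2) \<tau> by (simp add: mult_right_mono)
    finally show ?thesis .
  qed
  have "card P1 \<le> card {..<N}"
    by (rule card_inj_on_le[of fst]) (use inj in \<open>auto simp: P1_def inj_on_def\<close>)
  moreover have "card P2 \<le> card {..<N}"
    by (rule card_inj_on_le[of snd]) (use inj in \<open>auto simp: P2_def inj_on_def\<close>)
  ultimately have "psum w P1 y \<le> real N * \<tau>" "psum w P2 y \<le> real N * \<tau>"
    using fin by (auto intro!: small simp: P1_def P2_def)
  moreover have "psum w P y \<le> psum w (P1 \<union> P2) y + psum w Q y"
  proof -
    have "P = (P1 \<union> P2) \<union> Q" by (auto simp: Q_def P1_def P2_def)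
    then have "psum w P y = psum w ((P1 \<union> P2) \<union> Q) y" by simp
    also have "\<dots> = psum w (P1 \<union> P2) y + psum w Q y"
      unfolding psum_def using fin by (intro sum.union_disjoint) (auto simp: Q_def P1_def P2_def)
    finally show ?thesis by simp
  qed
  moreover have "psum w (P1 \<union> P2) y \<le> psum w P1 y + psum w P2 y"
    unfolding psum_def using fin w_nonneg
    by (subst sum.union_inter[symmetric]) (auto simp: P1_def P2_def intro!: sum_nonneg)
  ultimately have "\<delta> - 2 * real N * \<tau> \<le> psum w Q y" using P(2) by linarith
  moreover have "pinj Q" by (rule pinj_subset[OF P(1)]) (auto simp: Q_def)
  moreover have "Q \<subseteq> {N..} \<times> {N..}" by (force simp: Q_def P1_def P2_def)
  ultimately show ?thesis by blast
qed

end

section \<open>Bounded operators and almost disjoint blocks\<close>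

lemma bounded_opD:
  assumes "bounded_op X nX Y nY T"
  shows "x \<in> X \<Longrightarrow> T x \<in> Y"
    and "x \<in> X \<Longrightarrow> y \<in> X \<Longrightarrow> T (\<lambda>n. x n + y n) = (\<lambda>n. T x n + T y n)"
    and "x \<in> X \<Longrightarrow> T (\<lambda>n. c * x n) = (\<lambda>n. c * T x n)"
  using assms unfolding bounded_op_def by blast+

lemma bounded_op_bound:
  assumes "bounded_op X nX Y nY T" "\<And>x. x \<in> X \<Longrightarrow> 0 \<le> nX x"
  obtains C where "0 < C" "\<And>x. x \<in> X \<Longrightarrow> nY (T x) \<le> C * nX x"
proof -
  obtain C where C: "\<forall>x\<in>X. nY (T x) \<le> C * nX x" using assms(1) unfolding bounded_op_def by blast
  have "nY (T x) \<le> (\<bar>C\<bar> + 1) * nX x" if "x \<in> X" for x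
  proof -
    have "C * nX x \<le> (\<bar>C\<bar> + 1) * nX x" using assms(2)[OF that] by (intro mult_right_mono) auto
    then show ?thesis using C that by force
  qed
  then show thesis using that[of "\<bar>C\<bar> + 1"] by simp
qed

lemma bounded_op_zero:
  assumes "bounded_op X nX Y nY T" "lin_subspace X" shows "T (\<lambda>n. 0) = (\<lambda>n. 0)"
  using bounded_opD(3)[OF assms(1), of "\<lambda>n. 0" 0] assms(2) by (simp add: lin_subspace_def)

lemma bounded_op_diff:
  assumes T: "bounded_op X nX Y nY T" "lin_subspace X" and "x \<in> X" "y \<in> X"
  shows "T (\<lambda>n. x n - y n) = (\<lambda>n. T x n - T y n)"
proof -
  have "(\<lambda>n. -1 * y n) \<in> X" using assms(2,4) unfolding lin_subspace_def by blast
  from bounded_opD(2)[OF T(1) assms(3) this] bounded_opD(3)[OF T(1) assms(4), of "-1"]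
  show ?thesis by simp
qed

lemma lin_subspace_sum:
  assumes X: "lin_subspace X"
  shows "finite K \<Longrightarrow> (\<And>k. k \<in> K \<Longrightarrow> d k \<in> X) \<Longrightarrow> (\<lambda>n. \<Sum>k\<in>K. c k * d k n) \<in> X"
proof (induction K rule: finite_induct)
  case empty show ?case using X by (simp add: lin_subspace_def)
next
  case (insert k K)
  have "(\<lambda>n. c k * d k n) \<in> X" using insert.prems X by (simp add: lin_subspace_def)
  then show ?case using insert X by (simp add: lin_subspace_def)
qed

lemma bounded_op_sum:
  assumes T: "bounded_op X nX Y nY T" and X: "lin_subspace X"
  shows "finite K \<Longrightarrow> (\<And>k. k \<in> K \<Longrightarrow> d k \<in> X) \<Longrightarrow>
    T (\<lambda>n. \<Sum>k\<in>K. c k * d k n) = (\<lambda>n. \<Sum>k\<in>K. c k * T (d k) n)"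
proof (induction K rule: finite_induct)
  case empty show ?case using bounded_op_zero[OF T X] by simp
next
  case (insert k K)
  have "(\<lambda>n. c k * d k n) \<in> X" using insert.prems X by (simp add: lin_subspace_def)
  moreover have "(\<lambda>n. \<Sum>k\<in>K. c k * d k n) \<in> X"
    using insert by (intro lin_subspace_sum[OF X]) auto
  ultimately show ?case
    using insert bounded_opD(2)[OF T] bounded_opD(3)[OF T, of "d k" "c k"] by simp
qed

lemma bounded_op_compose:
  assumes S: "bounded_op X nX Y nY S" and T: "bounded_op Y nY Z nZ T"
    and "\<And>y. y \<in> Y \<Longrightarrow> 0 \<le> nY y"
  shows "bounded_op X nX Z nZ (\<lambda>x. T (S x))"
proof -
  obtain C where C: "\<forall>x\<in>X. nY (S x) \<le> C * nX x" using S unfolding bounded_op_def by blast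
  obtain D where D: "0 < D" "\<And>y. y \<in> Y \<Longrightarrow> nZ (T y) \<le> D * nY y"
    using bounded_op_bound[OF T assms(3)] by blast
  have "nZ (T (S x)) \<le> D * C * nX x" if x: "x \<in> X" for x
  proof -
    have "nZ (T (S x)) \<le> D * nY (S x)" by (rule D(2)[OF bounded_opD(1)[OF S x]])
    also have "\<dots> \<le> D * (C * nX x)" using C x D(1) by (intro mult_left_mono) auto
    finally show ?thesis by simp
  qed
  then show ?thesis
    unfolding bounded_op_def
    using bounded_opD(1)[OF S] bounded_opD(2)[OF S] bounded_opD(3)[OF S]
      bounded_opD(1)[OF T] bounded_opD(2)[OF T] bounded_opD(3)[OF T] by auto
qed

text \<open>Exchange argument: a spanning set \<open>B\<close> would have to accommodate
  \<open>card B + 1\<close> independent vectors. Sequences are interpreted as a vector space locally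
  in order to use the dimension bound.\<close>

lemma infinite_dimI:
  fixes d :: "nat \<Rightarrow> nat \<Rightarrow> real"
  assumes d: "\<And>k. d k \<in> M"
    and indep: "\<And>K c. \<forall>n. (\<Sum>k<K. c k * d k n) = 0 \<Longrightarrow> \<forall>k<K. c k = 0"
  shows "infinite_dim M"
  unfolding infinite_dim_def
proof clarify
  interpret vs: vector_space "\<lambda>(c::real) (f::nat \<Rightarrow> real). (\<lambda>n. c * f n)"
    by unfold_locales (auto simp: fun_eq_iff algebra_simps)
  have sum_app: "(\<Sum>a\<in>S. g a) n = (\<Sum>a\<in>S. g a n)" for S and g :: "'a \<Rightarrow> nat \<Rightarrow> real" and n
    by (induction S rule: infinite_finite_induct) auto
  fix B assume B: "finite B" "B \<subseteq> M" "\<forall>x\<in>M. \<exists>c. x = (\<lambda>n. \<Sum>b\<in>B. c b * b n)"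
  \<comment> \<open>Independence below concerns the image set of \<open>d\<close>, so repetitions
    must be excluded: \<open>d i = d j\<close> would give the vanishing combination with
    coefficients 1 and -1.\<close>
  have inj: "inj d"
  proof (rule injI, rule ccontr)
    fix i j assume ij: "d i = d j" "i \<noteq> j"
    let ?c = "\<lambda>k. (if k = i then 1 else 0) - (if k = j then 1 else (0::real))"
    define K where "K = Suc (max i j)"
    have K: "i < K" "j < K" by (auto simp: K_def)
    have "(\<Sum>k<K. ?c k * d k n) = 0" for n
    proof -
      have "(\<Sum>k<K. ?c k * d k n)
        = (\<Sum>k<K. if k = i then d k n else 0) - (\<Sum>k<K. if k = j then d k n else 0)"
        unfolding sum_subtractf[symmetric] by (intro sum.cong) auto
      also have "\<dots> = 0" using K by (simp add: fun_cong[OF ij(1), of n])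
      finally show ?thesis .
    qed
    then have "\<forall>k<K. ?c k = 0" by (intro indep) auto
    then have "?c i = 0" using K by blast
    then show False using ij(2) by simp
  qed
  let ?K = "Suc (card B)"
  have "vs.independent (d ` {..<?K})"
  proof (rule vs.independent_if_scalars_zero)
    fix f x assume f: "(\<Sum>x\<in>d ` {..<?K}. (\<lambda>n. f x * x n)) = 0" and x: "x \<in> d ` {..<?K}"
    have "(\<Sum>k<?K. f (d k) * d k n) = 0" for n
    proof -
      have "(\<Sum>k<?K. f (d k) * d k n) = (\<Sum>x\<in>d ` {..<?K}. (\<lambda>n. f x * x n)) n"
        unfolding sum_app using inj by (subst sum.reindex) (auto intro: inj_on_subset)
      then show ?thesis using f by simp
    qed
    then have "\<forall>k<?K. f (d k) = 0" by (intro indep) auto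
    then show "f x = 0" using x by auto
  qed simp
  moreover have "d ` {..<?K} \<subseteq> vs.span B"
  proof
    fix x assume "x \<in> d ` {..<?K}"
    then have "x \<in> M" using d by auto
    then obtain c where "x = (\<lambda>n. \<Sum>b\<in>B. c b * b n)" using B(3) by blast
    then have "x = (\<Sum>b\<in>B. (\<lambda>n. c b * b n))" by (auto simp: sum_app)
    also have "\<dots> \<in> vs.span B" by (intro vs.span_sum vs.span_scale vs.span_base)
    finally show "x \<in> vs.span B" .
  qed
  ultimately have "card (d ` {..<?K}) \<le> card B" using vs.independent_span_bound[OF B(1)] by blast
  moreover have "card (d ` {..<?K}) = ?K"
    using inj by (subst card_image) (auto intro: inj_on_subset)
  ultimately show False by simp
qed

section \<open>Construction of blocks and their l1 lower estimate\<close>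

context lorentz_weight
begin

abbreviation "X \<equiv> dw1 w"
abbreviation "nm \<equiv> lorentz_norm w"

lemma lin_subspace_dw1: "lin_subspace X"
  unfolding lin_subspace_def by (auto intro: dw1_zero lorentz_add(1) lorentz_scale_le(1))

text \<open>The order of choices matters: \<open>a\<close> is late enough for the heads below
  \<open>N\<close> to be near their limit, \<open>N'\<close> passes the essential part of
  \<open>t a\<close>, \<open>b\<close> makes \<open>y b\<close> flat relative to \<open>N'\<close>,
  and \<open>M\<close> closes the block after \<open>P\<close> and the essential part of
  \<open>t b\<close>. The main term loses one \<open>\<eta>\<close> to flatness and one to
  \<open>t a\<close>; the tail bound adds two tails.\<close>

lemma block_step:
  assumes t: "\<And>m. t m \<in> X" and y: "\<And>m. y m \<in> X"
    and le: "\<And>m i. \<bar>y m i\<bar> \<le> \<bar>t m i\<bar>" and big: "\<And>m. \<delta> < nm (y m)"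
    and flat: "\<And>m i. \<bar>y m i\<bar> \<le> \<tau> m" and \<tau>: "\<tau> \<longlonglongrightarrow> 0"
    and conv: "\<And>i. \<exists>l. (\<lambda>m. t m i) \<longlonglongrightarrow> l" and \<eta>: "0 < \<eta>"
  shows "\<exists>a b M P. N \<le> M \<and> pinj P \<and> P \<subseteq> {N..<M} \<times> {N..<M}
    \<and> (\<Sum>i<N. \<bar>t b i - t a i\<bar>) \<le> \<eta> \<and> nm (tail M (\<lambda>i. t b i - t a i)) \<le> 2 * \<eta>
    \<and> \<delta> - 2 * \<eta> \<le> psum w P (\<lambda>i. t b i - t a i)"
proof -
  obtain l where l: "\<And>i. (\<lambda>m. t m i) \<longlonglongrightarrow> l i" using conv by metis
  have "(\<lambda>m. \<Sum>i<N. \<bar>t m i - l i\<bar>) \<longlonglongrightarrow> (\<Sum>i<N. \<bar>l i - l i\<bar>)"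
    by (intro tendsto_intros l)
  then have lim: "(\<lambda>m. \<Sum>i<N. \<bar>t m i - l i\<bar>) \<longlonglongrightarrow> 0" by simp
  obtain a where a: "\<And>m. m \<ge> a \<Longrightarrow> (\<Sum>i<N. \<bar>t m i - l i\<bar>) < \<eta> / 2"
    using LIMSEQ_D[OF lim, of "\<eta>/2"] \<eta> by (auto simp: sum_nonneg)
  obtain N1 where N1: "\<And>N. N \<ge> N1 \<Longrightarrow> nm (tail N (t a)) \<le> \<eta>" using tail_small[OF t \<eta>] by blast
  \<comment> \<open>The pairs in \<open>P\<close> will start at \<open>N'\<close>, not merely at
    \<open>N\<close>, so that subtracting \<open>t a\<close> costs at most \<open>\<eta>\<close> on
    them.\<close>
  define N' where "N' = max N N1"
  have "(\<lambda>m. 2 * real N' * \<tau> m) \<longlonglongrightarrow> 0" using tendsto_mult_right_zero[OF \<tau>] by simp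
  then obtain b0 where b0: "\<And>m. m \<ge> b0 \<Longrightarrow> \<bar>2 * real N' * \<tau> m\<bar> < \<eta>"
    using LIMSEQ_D[of _ 0 \<eta>] \<eta> by (metis diff_zero real_norm_def)
  define b where "b = max a b0"
  obtain P where P: "pinj P" "P \<subseteq> {N'..} \<times> {N'..}" "\<delta> - 2 * real N' * \<tau> b \<le> psum w P (y b)"
    using psum_flat_witness[OF y big flat] by blast
  obtain N2 where N2: "\<And>N. N \<ge> N2 \<Longrightarrow> nm (tail N (t b)) \<le> \<eta>" using tail_small[OF t \<eta>] by blast
  have "finite (fst ` P \<union> snd ` P)" using P(1) by (auto simp: pinj_def)
  then obtain N3 where N3: "fst ` P \<union> snd ` P \<subseteq> {..<N3}" using finite_nat_iff_bounded by auto
  define M where "M = max N' (max N2 N3)"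
  let ?v = "\<lambda>i. t b i - t a i"
  have "(\<Sum>i<N. \<bar>?v i\<bar>) \<le> (\<Sum>i<N. \<bar>t b i - l i\<bar>) + (\<Sum>i<N. \<bar>t a i - l i\<bar>)"
    unfolding sum.distrib[symmetric] by (intro sum_mono) auto
  then have 1: "(\<Sum>i<N. \<bar>?v i\<bar>) \<le> \<eta>" using a[of b] a[of a] by (simp add: b_def)
  have "tail M ?v = (\<lambda>i. tail M (t b) i - tail M (t a) i)" by (auto simp: tail_def)
  then have "nm (tail M ?v) \<le> nm (tail M (t b)) + nm (tail M (t a))"
    using lorentz_diff(2)[OF tail_dw1[OF t] tail_dw1[OF t]] by simp
  moreover have "N1 \<le> M" "N2 \<le> M" by (auto simp: M_def N'_def)
  ultimately have 2: "nm (tail M ?v) \<le> 2 * \<eta>" using N1[of M] N2[of M] by linarith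
  have "psum w P (y b) \<le> psum w P (t b)" by (rule psum_mono[OF w_nonneg]) (rule le)
  also have "\<dots> \<le> psum w P ?v + psum w P (t a)"
    using psum_add_le[of w P ?v "t a", OF w_nonneg] by simp
  also have "psum w P (t a) \<le> nm (tail N' (t a))" by (rule psum_tail_le[OF t P(1)]) (use P(2) in auto)
  also have "\<dots> \<le> \<eta>" by (rule N1) (simp add: N'_def)
  finally have 3: "\<delta> - 2 * \<eta> \<le> psum w P ?v" using P(3) b0[of b] by (simp add: b_def)
  have 4: "P \<subseteq> {N..<M} \<times> {N..<M}"
  proof
    fix p assume p: "p \<in> P"
    then have "fst p \<in> {N'..}" "snd p \<in> {N'..}" "fst p \<in> {..<N3}" "snd p \<in> {..<N3}"
      using P(2) N3 by auto
    then show "p \<in> {N..<M} \<times> {N..<M}" by (cases p) (auto simp: M_def N'_def)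
  qed
  have "N \<le> M" by (simp add: M_def N'_def)
  then show ?thesis using P(1) 1 2 3 4 by blast
qed

text \<open>The sets \<open>P j\<close> combine into a single partial injection, so their weighted
  sums add up below the norm. Each \<open>v k\<close> contributes at least
  \<open>\<delta> - 2 * \<eta>\<close> on its own block and leaks at most \<open>3 * \<eta>\<close>
  into the others, which leaves \<open>\<delta> - 5 * \<eta>\<close> per coefficient.\<close>

lemma almost_disjoint_l1_lower_bound:
  fixes v :: "nat \<Rightarrow> nat \<Rightarrow> real" and N :: "nat \<Rightarrow> nat"
  assumes v: "\<And>k. v k \<in> X" and N: "\<And>k. N k \<le> N (Suc k)" and P: "\<And>k. pinj (P k)"
    and sub: "\<And>k. P k \<subseteq> {N k..<N (Suc k)} \<times> {N k..<N (Suc k)}"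
    and head: "\<And>k. (\<Sum>i<N k. \<bar>v k i\<bar>) \<le> \<eta>"
    and tl: "\<And>k. nm (tail (N (Suc k)) (v k)) \<le> 2 * \<eta>"
    and main: "\<And>k. \<delta> - 2 * \<eta> \<le> psum w (P k) (v k)"
  shows "(\<delta> - 5 * \<eta>) * (\<Sum>k<K. \<bar>c k\<bar>) \<le> nm (\<lambda>n. \<Sum>k<K. c k * v k n)"
proof -
  have N_mono: "N i \<le> N j" if "i \<le> j" for i j
    using lift_Suc_mono_le[of N i j] N that by blast
  have fin: "finite (P k)" for k using P by (simp add: pinj_def)
  \<comment> \<open>Successive intervals separate coordinates and weight indices alike; both are
    needed for the union to be injective in each component.\<close>
  have eq: "i = j" if "p \<in> P i" "q \<in> P j" "fst p = fst q \<or> snd p = snd q" for p q i j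
  proof (rule ccontr)
    have "p \<in> {N i..<N (Suc i)} \<times> {N i..<N (Suc i)}" "q \<in> {N j..<N (Suc j)} \<times> {N j..<N (Suc j)}"
      using sub that by blast+
    moreover assume "i \<noteq> j"
    then have "Suc i \<le> j \<or> Suc j \<le> i" by linarith
    then have "N (Suc i) \<le> N j \<or> N (Suc j) \<le> N i" using N_mono by blast
    ultimately show False using that(3) by auto
  qed
  have U: "pinj (\<Union>j\<in>J. P j)" if "finite J" for J
    unfolding pinj_def
  proof (intro conjI inj_onI)
    show "finite (\<Union>j\<in>J. P j)" using that fin by auto
    fix p q assume pq: "p \<in> (\<Union>j\<in>J. P j)" "q \<in> (\<Union>j\<in>J. P j)"
    { assume f: "fst p = fst q"
      then obtain j where "p \<in> P j" "q \<in> P j" using pq eq by blast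
      then show "p = q" using P f by (auto simp: pinj_def dest: inj_onD) }
    { assume f: "snd p = snd q"
      then obtain j where "p \<in> P j" "q \<in> P j" using pq eq by blast
      then show "p = q" using P f by (auto simp: pinj_def dest: inj_onD) }
  qed
  have psum_U: "psum w (\<Union>j\<in>J. P j) x = (\<Sum>j\<in>J. psum w (P j) x)" if "finite J" for J x
    unfolding psum_def using that fin eq by (intro sum.UNION_disjoint) blast+
  \<comment> \<open>Earlier blocks lie in the head of \<open>v k\<close> and receive at most
    \<open>\<eta>\<close>; later blocks lie in its tail and receive at most
    \<open>2 * \<eta>\<close>.\<close>
  have cross: "(\<Sum>j<K. psum w (P j) (v k)) \<le> psum w (P k) (v k) + 3 * \<eta>" if k: "k < K" for k
  proof -
    have "(\<Sum>j<K. psum w (P j) (v k)) = (\<Sum>j<k. psum w (P j) (v k))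
      + psum w (P k) (v k) + (\<Sum>j\<in>{Suc k..<K}. psum w (P j) (v k))"
    proof -
      have "{..<K} = {..<k} \<union> ({k} \<union> {Suc k..<K})" using k by auto
      moreover have "{..<k} \<inter> {Suc k..<K} = {}" by auto
      ultimately show ?thesis by (simp add: sum.union_disjoint)
    qed
    moreover have "(\<Sum>j<k. psum w (P j) (v k)) \<le> \<eta>"
    proof -
      have "fst ` (\<Union>j\<in>{..<k}. P j) \<subseteq> {..<N k}"
      proof (rule image_subsetI)
        fix p assume "p \<in> (\<Union>j\<in>{..<k}. P j)"
        then obtain j where j: "j \<in> {..<k}" "p \<in> P j" by blast
        then have "fst p < N (Suc j)" using sub[of j] by auto
        also have "\<dots> \<le> N k" using j by (intro N_mono) auto
        finally show "fst p \<in> {..<N k}" by simp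
      qed
      then have "psum w (\<Union>j\<in>{..<k}. P j) (v k) \<le> (\<Sum>i<N k. \<bar>v k i\<bar>)"
        by (intro psum_le_sum_coords U) auto
      then show ?thesis using psum_U[of "{..<k}"] head[of k] by simp
    qed
    moreover have "(\<Sum>j\<in>{Suc k..<K}. psum w (P j) (v k)) \<le> 2 * \<eta>"
    proof -
      have "fst ` (\<Union>j\<in>{Suc k..<K}. P j) \<subseteq> {N (Suc k)..}"
      proof (rule image_subsetI)
        fix p assume "p \<in> (\<Union>j\<in>{Suc k..<K}. P j)"
        then obtain j where j: "j \<in> {Suc k..<K}" "p \<in> P j" by blast
        then have "N j \<le> fst p" using sub[of j] by auto
        moreover have "N (Suc k) \<le> N j" using j by (intro N_mono) auto
        ultimately show "fst p \<in> {N (Suc k)..}" by simp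
      qed
      then have "psum w (\<Union>j\<in>{Suc k..<K}. P j) (v k) \<le> nm (tail (N (Suc k)) (v k))"
        by (intro psum_tail_le v U) auto
      then show ?thesis using psum_U[of "{Suc k..<K}"] tl[of k] by simp
    qed
    ultimately show ?thesis by linarith
  qed
  let ?V = "\<lambda>n. \<Sum>k<K. c k * v k n"
  have VX: "?V \<in> X" by (intro dw1_sum lorentz_scale_le(1) v) auto
  \<comment> \<open>This is the reverse triangle inequality with \<open>v j\<close> as main term;
    the factor 2 lets the subtracted sum run over all \<open>k\<close>, including \<open>j\<close>,
    so that the double sum can be swapped afterwards.\<close>
  have rev: "2 * \<bar>c j\<bar> * psum w (P j) (v j) - (\<Sum>k<K. \<bar>c k\<bar> * psum w (P j) (v k))
    \<le> psum w (P j) ?V" if j: "j < K" for j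
  proof -
    have pt: "2 * \<bar>c j\<bar> * \<bar>v j i\<bar> - (\<Sum>k<K. \<bar>c k\<bar> * \<bar>v k i\<bar>) \<le> \<bar>?V i\<bar>" for i
    proof -
      have "?V i = c j * v j i + (\<Sum>k\<in>{..<K}-{j}. c k * v k i)"
        using j by (subst sum.remove[of _ j]) auto
      moreover have "\<bar>\<Sum>k\<in>{..<K}-{j}. c k * v k i\<bar> \<le> (\<Sum>k\<in>{..<K}-{j}. \<bar>c k\<bar> * \<bar>v k i\<bar>)"
        using sum_abs[of "\<lambda>k. c k * v k i" "{..<K}-{j}"] by (simp add: abs_mult)
      moreover have "(\<Sum>k<K. \<bar>c k\<bar> * \<bar>v k i\<bar>)
        = \<bar>c j * v j i\<bar> + (\<Sum>k\<in>{..<K}-{j}. \<bar>c k\<bar> * \<bar>v k i\<bar>)"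
        using j by (subst sum.remove[of _ j]) (auto simp: abs_mult)
      moreover have "\<bar>c j\<bar> * \<bar>v j i\<bar> = \<bar>c j * v j i\<bar>" by (simp add: abs_mult)
      ultimately show ?thesis by linarith
    qed
    have "2 * \<bar>c j\<bar> * psum w (P j) (v j) - (\<Sum>k<K. \<bar>c k\<bar> * psum w (P j) (v k))
      = (\<Sum>p\<in>P j. w (snd p) * (2 * \<bar>c j\<bar> * \<bar>v j (fst p)\<bar> - (\<Sum>k<K. \<bar>c k\<bar> * \<bar>v k (fst p)\<bar>)))"
    proof -
      have "(\<Sum>k<K. \<bar>c k\<bar> * psum w (P j) (v k))
        = (\<Sum>p\<in>P j. w (snd p) * (\<Sum>k<K. \<bar>c k\<bar> * \<bar>v k (fst p)\<bar>))"
        unfolding psum_def sum_distrib_left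
        by (subst sum.swap) (intro sum.cong refl, simp add: mult_ac)
      then show ?thesis
        by (simp add: psum_def sum_distrib_left right_diff_distrib sum_subtractf mult_ac)
    qed
    also have "\<dots> \<le> psum w (P j) ?V"
      unfolding psum_def using pt w_nonneg by (intro sum_mono mult_left_mono) auto
    finally show ?thesis .
  qed
  have "(\<delta> - 5 * \<eta>) * (\<Sum>k<K. \<bar>c k\<bar>)
    \<le> (\<Sum>k<K. \<bar>c k\<bar> * (2 * psum w (P k) (v k) - (\<Sum>j<K. psum w (P j) (v k))))"
    unfolding sum_distrib_left
  proof (rule sum_mono)
    fix k assume k: "k \<in> {..<K}"
    have "\<delta> - 5 * \<eta> \<le> 2 * psum w (P k) (v k) - (\<Sum>j<K. psum w (P j) (v k))"
      using cross[of k] main[of k] k by simp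
    from mult_left_mono[OF this, of "\<bar>c k\<bar>"]
    show "(\<delta> - 5 * \<eta>) * \<bar>c k\<bar>
      \<le> \<bar>c k\<bar> * (2 * psum w (P k) (v k) - (\<Sum>j<K. psum w (P j) (v k)))"
      by (simp add: mult.commute)
  qed
  also have "\<dots> = (\<Sum>j<K. 2 * \<bar>c j\<bar> * psum w (P j) (v j) - (\<Sum>k<K. \<bar>c k\<bar> * psum w (P j) (v k)))"
  proof -
    have "(\<Sum>k<K. \<bar>c k\<bar> * (\<Sum>j<K. psum w (P j) (v k)))
      = (\<Sum>j<K. \<Sum>k<K. \<bar>c k\<bar> * psum w (P j) (v k))"
      unfolding sum_distrib_left by (rule sum.swap)
    then show ?thesis by (simp add: right_diff_distrib sum_subtractf mult_ac)
  qed
  also have "\<dots> \<le> (\<Sum>j<K. psum w (P j) ?V)" using rev by (intro sum_mono) auto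
  also have "\<dots> = psum w (\<Union>j\<in>{..<K}. P j) ?V" using psum_U[of "{..<K}"] by simp
  also have "\<dots> \<le> nm ?V" by (intro psum_le_lorentz VX U) auto
  finally show ?thesis .
qed

end

section \<open>Failure of strict singularity\<close>

context lorentz_weight
begin

text \<open>On finite combinations the norm is at most \<open>C\<close> times the sum of the
  \<open>\<bar>c k\<bar>\<close>, while the image has norm at least \<open>\<gamma>\<close> times
  that sum. Hence \<open>T\<close> is bounded below by \<open>\<gamma> / C\<close> on the span, and
  by continuity on its closure \<open>M\<close>.\<close>

lemma not_strictly_singularI:
  fixes d :: "nat \<Rightarrow> nat \<Rightarrow> real"
  assumes T: "bounded_op X nm X nm T" and d: "\<And>k. d k \<in> X" and dC: "\<And>k. nm (d k) \<le> C"
    and C: "0 < C" and \<gamma>: "0 < \<gamma>"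
    and lower: "\<And>K c. \<gamma> * (\<Sum>k<K. \<bar>c k\<bar>) \<le> nm (\<lambda>n. \<Sum>k<K. c k * T (d k) n)"
  shows "\<not> strictly_singular X nm nm T"
proof -
  define comb where "comb K c = (\<lambda>n. \<Sum>k<K. c k * d k n)" for K :: nat and c :: "nat \<Rightarrow> real"
  define M where "M = {x \<in> X. \<forall>e>0. \<exists>K c. nm (\<lambda>n. x n - comb K c n) < e}"
  have comb_X: "comb K c \<in> X" for K c
    unfolding comb_def by (rule lin_subspace_sum[OF lin_subspace_dw1]) (auto intro: d)
  have T_comb: "T (comb K c) = (\<lambda>n. \<Sum>k<K. c k * T (d k) n)" for K c
    unfolding comb_def by (rule bounded_op_sum[OF T lin_subspace_dw1]) (auto intro: d)
  \<comment> \<open>Padding with zero coefficients brings two combinations to a common length, so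
    that they can be added.\<close>
  have comb_pad: "comb K' (\<lambda>k. if k < K then c k else 0) = comb K c" if "K \<le> K'" for K K' c
  proof
    fix n
    show "comb K' (\<lambda>k. if k < K then c k else 0) n = comb K c n"
      unfolding comb_def using that by (intro sum.mono_neutral_cong_right) auto
  qed
  have M_X: "x \<in> X" if "x \<in> M" for x using that by (simp add: M_def)
  have comb_M: "comb K c \<in> M" for K c
    unfolding M_def using comb_X by (auto intro!: exI[of _ K] exI[of _ c] simp: lorentz_zero)
  have "lin_subspace M"
    unfolding lin_subspace_def
  proof (intro conjI ballI allI)
    show "(\<lambda>n. 0) \<in> M" using comb_M[of 0] by (simp add: comb_def)
  next
    fix x y assume xy: "x \<in> M" "y \<in> M"
    have "\<exists>K c. nm (\<lambda>n. (x n + y n) - comb K c n) < e" if e: "e > 0" for e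
    proof -
      obtain K1 c1 K2 c2 where c: "nm (\<lambda>n. x n - comb K1 c1 n) < e / 2" "nm (\<lambda>n. y n - comb K2 c2 n) < e / 2"
        using xy e unfolding M_def by (auto dest!: spec[of _ "e/2"])
      let ?c = "\<lambda>k. (if k < K1 then c1 k else 0) + (if k < K2 then c2 k else 0)"
      have "comb (max K1 K2) ?c n = comb K1 c1 n + comb K2 c2 n" for n
      proof -
        have "comb (max K1 K2) ?c n = comb (max K1 K2) (\<lambda>k. if k < K1 then c1 k else 0) n
          + comb (max K1 K2) (\<lambda>k. if k < K2 then c2 k else 0) n"
          unfolding comb_def sum.distrib[symmetric] distrib_right ..
        then show ?thesis by (simp add: comb_pad)
      qed
      then have "(\<lambda>n. (x n + y n) - comb (max K1 K2) ?c n)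
        = (\<lambda>n. (x n - comb K1 c1 n) + (y n - comb K2 c2 n))" by auto
      then have "nm (\<lambda>n. (x n + y n) - comb (max K1 K2) ?c n) < e"
        using lorentz_add(2)[OF lorentz_diff(1)[OF M_X[OF xy(1)] comb_X]
            lorentz_diff(1)[OF M_X[OF xy(2)] comb_X], of K1 c1 K2 c2] c by simp
      then show ?thesis by blast
    qed
    then show "(\<lambda>n. x n + y n) \<in> M"
      unfolding M_def using lorentz_add(1)[OF xy[THEN M_X]] by blast
  next
    fix a x assume x: "x \<in> M"
    have "\<exists>K c. nm (\<lambda>n. a * x n - comb K c n) < e" if e: "e > 0" for e
    proof -
      have "0 < e / (\<bar>a\<bar> + 1)" using e by (intro divide_pos_pos) auto
      then obtain K c where c: "nm (\<lambda>n. x n - comb K c n) < e / (\<bar>a\<bar> + 1)"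
        using x unfolding M_def by blast
      have "(\<lambda>n. a * x n - comb K (\<lambda>k. a * c k) n) = (\<lambda>n. a * (x n - comb K c n))"
        by (auto simp: comb_def sum_distrib_left right_diff_distrib mult_ac)
      then have "nm (\<lambda>n. a * x n - comb K (\<lambda>k. a * c k) n) = \<bar>a\<bar> * nm (\<lambda>n. x n - comb K c n)"
        using lorentz_scale[OF lorentz_diff(1)[OF M_X[OF x] comb_X]] by simp
      also have "\<dots> \<le> \<bar>a\<bar> * (e / (\<bar>a\<bar> + 1))" using c by (intro mult_left_mono) auto
      also have "\<dots> < e" using e by (simp add: field_simps)
      finally show ?thesis by blast
    qed
    then show "(\<lambda>n. a * x n) \<in> M"
      unfolding M_def using lorentz_scale_le(1)[OF M_X[OF x]] by blast
  qed
  moreover have "infinite_dim M"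
  proof (rule infinite_dimI)
    fix k
    have "comb (Suc k) (\<lambda>j. if j = k then 1 else 0) n = d k n" for n
    proof -
      have "comb (Suc k) (\<lambda>j. if j = k then 1 else 0) n = (\<Sum>j<Suc k. if j = k then d j n else 0)"
        unfolding comb_def by (intro sum.cong) auto
      then show ?thesis by simp
    qed
    then show "d k \<in> M" using comb_M[of "Suc k" "\<lambda>j. if j = k then 1 else 0"] by presburger
  next
    fix K c assume "\<forall>n. (\<Sum>k<K. c k * d k n) = 0"
    \<comment> \<open>A vanishing combination has image 0, so the lower estimate forces all its
      coefficients to vanish.\<close>
    then have "comb K c = (\<lambda>n. 0)" by (simp add: comb_def)
    then have "nm (\<lambda>n. \<Sum>k<K. c k * T (d k) n) = 0"
      using T_comb[of K c] bounded_op_zero[OF T lin_subspace_dw1] lorentz_zero by simp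
    then have "\<gamma> * (\<Sum>k<K. \<bar>c k\<bar>) \<le> 0" using lower[where K = K and c = c] by simp
    then have "(\<Sum>k<K. \<bar>c k\<bar>) \<le> 0" using \<gamma> by (simp add: mult_le_0_iff)
    moreover have "0 \<le> (\<Sum>k<K. \<bar>c k\<bar>)" by (intro sum_nonneg) auto
    ultimately have "(\<Sum>k<K. \<bar>c k\<bar>) = 0" by linarith
    then show "\<forall>k<K. c k = 0" by (subst (asm) sum_nonneg_eq_0_iff) auto
  qed
  moreover have "norm_closed X nm M"
    unfolding norm_closed_def
  proof clarify
    fix f x assume f: "\<forall>k. f k \<in> M" and x: "x \<in> X" and lim: "(\<lambda>k. nm (\<lambda>n. f k n - x n)) \<longlonglongrightarrow> 0"
    have "\<exists>K c. nm (\<lambda>n. x n - comb K c n) < e" if e: "e > 0" for e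
    proof -
      obtain k where k: "nm (\<lambda>n. f k n - x n) < e / 2"
        using order_tendstoD(2)[OF lim, of "e/2"] e by (auto simp: eventually_sequentially)
      obtain K c where c: "nm (\<lambda>n. f k n - comb K c n) < e / 2"
        using f e unfolding M_def by (auto dest!: spec[of _ k] spec[of _ "e/2"])
      have "f k \<in> X" using f M_X by blast
      then have "nm (\<lambda>n. (f k n - comb K c n) - (f k n - x n))
        \<le> nm (\<lambda>n. f k n - comb K c n) + nm (\<lambda>n. f k n - x n)"
        by (intro lorentz_diff comb_X x)
      then have "nm (\<lambda>n. x n - comb K c n) < e" using k c by simp
      then show ?thesis by blast
    qed
    then show "x \<in> M" using x by (simp add: M_def)
  qed
  moreover have "(\<gamma> / C) * nm x \<le> nm (T x)" if x: "x \<in> M" for x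
  proof (rule field_le_epsilon)
    fix e :: real assume e: "0 < e"
    obtain L where L: "0 < L" "\<And>x. x \<in> X \<Longrightarrow> nm (T x) \<le> L * nm x"
      using bounded_op_bound[OF T lorentz_nonneg] by blast
    define g where "g = \<gamma> / C"
    have g: "0 < g" using \<gamma> C by (simp add: g_def)
    \<comment> \<open>Replacing \<open>x\<close> by a combination at distance below
      \<open>e'\<close> costs \<open>g * e'\<close> on the left and \<open>L * e'\<close> on the
      right, together \<open>e\<close>.\<close>
    define e' where "e' = e / (g + L)"
    have e': "0 < e'" "(g + L) * e' = e" using e g L by (auto simp: e'_def)
    obtain K c where c: "nm (\<lambda>n. x n - comb K c n) < e'" using x e' unfolding M_def by blast
    let ?v = "comb K c"
    have xX: "x \<in> X" by (rule M_X[OF x])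
    note vX = comb_X[of K c] and rX = lorentz_diff(1)[OF xX comb_X[of K c]]
    have "nm ?v \<le> (\<Sum>k<K. nm (\<lambda>n. c k * d k n))"
      unfolding comb_def by (rule lorentz_sum_le) (auto intro: lorentz_scale_le(1) d)
    also have "\<dots> \<le> (\<Sum>k<K. C * \<bar>c k\<bar>)"
      unfolding lorentz_scale[OF d] using dC
      by (intro sum_mono) (metis abs_ge_zero mult.commute mult_left_mono)
    finally have "nm ?v \<le> C * (\<Sum>k<K. \<bar>c k\<bar>)" by (simp add: sum_distrib_left)
    then have "g * nm ?v \<le> g * (C * (\<Sum>k<K. \<bar>c k\<bar>))" using g by (intro mult_left_mono) auto
    also have "\<dots> = \<gamma> * (\<Sum>k<K. \<bar>c k\<bar>)" using C by (simp add: g_def)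
    also have "\<dots> \<le> nm (T ?v)" using lower[where K = K and c = c] T_comb[of K c] by simp
    finally have v: "g * nm ?v \<le> nm (T ?v)" .
    have "nm x \<le> nm ?v + nm (\<lambda>n. x n - ?v n)" using lorentz_add(2)[OF vX rX] by simp
    then have "nm x \<le> nm ?v + e'" using c by linarith
    then have "g * nm x \<le> g * (nm ?v + e')" using g by (intro mult_left_mono) auto
    moreover have "nm (T ?v) \<le> nm (T x) + L * e'"
    proof -
      have "nm (\<lambda>n. T x n - T (\<lambda>n. x n - ?v n) n) \<le> nm (T x) + nm (T (\<lambda>n. x n - ?v n))"
        by (intro lorentz_diff bounded_opD(1)[OF T] xX rX)
      moreover have "nm (\<lambda>n. T x n - T (\<lambda>n. x n - ?v n) n) = nm (T ?v)"
        using bounded_op_diff[OF T lin_subspace_dw1 xX vX] by simp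
      moreover have "nm (T (\<lambda>n. x n - ?v n)) \<le> L * nm (\<lambda>n. x n - ?v n)" by (rule L(2)[OF rX])
      moreover have "\<dots> \<le> L * e'" using c L(1) by (intro mult_left_mono) auto
      ultimately show ?thesis by linarith
    qed
    ultimately have "g * nm x \<le> nm (T x) + (g + L) * e'" using v by (simp add: algebra_simps)
    then show "(\<gamma> / C) * nm x \<le> nm (T x) + e" using e'(2) by (simp add: g_def)
  qed
  moreover have "M \<subseteq> X" using M_X by blast
  moreover have "0 < \<gamma> / C" using \<gamma> C by simp
  ultimately show ?thesis unfolding strictly_singular_def by blast
qed

text \<open>Flatness and size are required only of the minorants \<open>y m\<close>; the blocks are
  nevertheless formed from differences of the \<open>T (x m)\<close>, because these are images under
  \<open>T\<close> of bounded vectors.\<close>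

lemma flat_minorants_not_strictly_singular:
  fixes x y :: "nat \<Rightarrow> nat \<Rightarrow> real"
  assumes T: "bounded_op X nm X nm T" and x: "\<And>m. x m \<in> X" and x1: "\<And>m. nm (x m) \<le> 1"
    and y: "\<And>m. y m \<in> X" and le: "\<And>m i. \<bar>y m i\<bar> \<le> \<bar>T (x m) i\<bar>"
    and \<delta>: "0 < \<delta>" and big: "\<And>m. \<delta> < nm (y m)"
    and flat: "\<And>m i. \<bar>y m i\<bar> \<le> \<tau> m" and \<tau>: "\<tau> \<longlonglongrightarrow> 0"
  shows "\<not> strictly_singular X nm nm T"
proof -
  obtain L where L: "0 < L" "\<And>x. x \<in> X \<Longrightarrow> nm (T x) \<le> L * nm x"
    using bounded_op_bound[OF T lorentz_nonneg] by blast
  have TX: "T (x m) \<in> X" for m by (rule bounded_opD(1)[OF T x])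
  have "\<bar>T (x m) i\<bar> \<le> L" for m i
  proof -
    have "\<bar>T (x m) i\<bar> \<le> nm (T (x m))" by (rule coord_le_lorentz[OF TX])
    also have "\<dots> \<le> L * nm (x m)" by (rule L(2)[OF x])
    also have "\<dots> \<le> L * 1" using x1 L(1) by (intro mult_left_mono) auto
    finally show ?thesis by simp
  qed
  \<comment> \<open>Diagonal extraction over the countable set of coordinates, each of which is
    bounded by \<open>L\<close>.\<close>
  then obtain r where r: "strict_mono (r :: nat \<Rightarrow> nat)" "\<And>i. \<exists>l. (\<lambda>m. T (x (r m)) i) \<longlonglongrightarrow> l"
    using function_convergent_subsequence[of "UNIV :: nat set" "\<lambda>m. T (x m)" L]
    by (metis UNIV_I countableI_type real_norm_def)
  \<comment> \<open>Any value below \<open>\<delta> / 5\<close> would serve; here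
    \<open>\<delta> - 5 * \<eta>\<close> equals \<open>3 * \<delta> / 8\<close>.\<close>
  define \<eta> where "\<eta> = \<delta> / 8"
  have \<eta>: "0 < \<eta>" using \<delta> by (simp add: \<eta>_def)
  define Q where "Q N a b M P \<longleftrightarrow> N \<le> M \<and> pinj P \<and> P \<subseteq> {N..<M} \<times> {N..<M}
    \<and> (\<Sum>i<N. \<bar>T (x (r b)) i - T (x (r a)) i\<bar>) \<le> \<eta>
    \<and> nm (tail M (\<lambda>i. T (x (r b)) i - T (x (r a)) i)) \<le> 2 * \<eta>
    \<and> \<delta> - 2 * \<eta> \<le> psum w P (\<lambda>i. T (x (r b)) i - T (x (r a)) i)" for N a b M P
  have "(\<lambda>m. \<tau> (r m)) \<longlonglongrightarrow> 0"
    using LIMSEQ_subseq_LIMSEQ[OF \<tau> r(1)] by (simp add: o_def)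
  then have "\<exists>a b M P. Q N a b M P" for N
    unfolding Q_def
    by (intro block_step[where y = "\<lambda>m. y (r m)" and \<tau> = "\<lambda>m. \<tau> (r m)"] TX y le big flat r(2) \<eta>)
  then obtain a b M P where Q: "\<And>N. Q N (a N) (b N) (M N) (P N)" by metis
  \<comment> \<open>Iterating \<open>M\<close> from 0 makes the end of each block the start of the
    next.\<close>
  define N where "N k = (M ^^ k) 0" for k
  have NS: "N (Suc k) = M (N k)" for k by (simp add: N_def)
  define d where "d k = (\<lambda>n. x (r (b (N k))) n - x (r (a (N k))) n)" for k
  have Td: "T (d k) = (\<lambda>n. T (x (r (b (N k)))) n - T (x (r (a (N k)))) n)" for k
    unfolding d_def by (rule bounded_op_diff[OF T lin_subspace_dw1 x x])
  have dX: "d k \<in> X" for k unfolding d_def by (rule lorentz_diff(1)[OF x x])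
  have d2: "nm (d k) \<le> 2" for k
    unfolding d_def
    using lorentz_diff(2)[OF x x, of "r (b (N k))" "r (a (N k))"] x1[of "r (b (N k))"] x1[of "r (a (N k))"]
    by linarith
  have "(\<delta> - 5 * \<eta>) * (\<Sum>k<K. \<bar>c k\<bar>) \<le> nm (\<lambda>n. \<Sum>k<K. c k * T (d k) n)" for K c
    by (rule almost_disjoint_l1_lower_bound[where N = N and P = "\<lambda>k. P (N k)"])
      (use Q bounded_opD(1)[OF T dX] in \<open>auto simp: Q_def Td NS\<close>)
  then show ?thesis
    by (rule not_strictly_singularI[OF T dX d2, rotated 2]) (use \<delta> in \<open>auto simp: \<eta>_def\<close>)
qed

end

section \<open>Operators on l1\<close>

lemma l1_norm_nonneg: "x \<in> l1 \<Longrightarrow> 0 \<le> l1_norm x"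
  unfolding l1_norm_def l1_def by (intro suminf_nonneg) auto

lemma l1_if_partial_sums_le:
  assumes "\<And>M. (\<Sum>i<M. \<bar>x i\<bar>) \<le> R"
  shows "x \<in> l1" "l1_norm x \<le> R"
proof -
  have "summable (\<lambda>i. \<bar>x i\<bar>)" using assms by (intro summableI_nonneg_bounded) auto
  then show "x \<in> l1" "l1_norm x \<le> R"
    using assms unfolding l1_def l1_norm_def by (auto intro!: suminf_le_const)
qed

lemma lin_subspace_l1: "lin_subspace l1"
  unfolding lin_subspace_def l1_def
proof (intro conjI ballI allI; clarsimp)
  fix x y :: "nat \<Rightarrow> real" assume "summable (\<lambda>n. \<bar>x n\<bar>)" "summable (\<lambda>n. \<bar>y n\<bar>)"
  then have "summable (\<lambda>n. \<bar>x n\<bar> + \<bar>y n\<bar>)" by (rule summable_add)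
  then show "summable (\<lambda>n. \<bar>x n + y n\<bar>)"
    by (rule summable_comparison_test'[where N = 0]) (simp add: abs_triangle_ineq)
next
  fix c and x :: "nat \<Rightarrow> real" assume "summable (\<lambda>n. \<bar>x n\<bar>)"
  then show "summable (\<lambda>n. \<bar>c * x n\<bar>)" unfolding abs_mult by (rule summable_mult)
qed

definition unit_seq :: "nat \<Rightarrow> nat \<Rightarrow> real" where
  "unit_seq n = (\<lambda>k. if k = n then 1 else 0)"

lemma unit_seq_sums: "(\<lambda>k. \<bar>unit_seq n k\<bar>) sums 1"
  using sums_single[of n "\<lambda>_. 1::real"] by (simp add: unit_seq_def if_distrib cong: if_cong)

lemma unit_seq_l1: "unit_seq n \<in> l1" and l1_norm_unit_seq: "l1_norm (unit_seq n) = 1"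
  using unit_seq_sums[of n] by (auto simp: l1_def l1_norm_def sums_iff)

lemma l1_norm_tail_tendsto:
  assumes v: "v \<in> l1"
  shows "tail N v \<in> l1" "(\<lambda>N. l1_norm (tail N v)) \<longlonglongrightarrow> 0"
proof -
  have sm: "summable (\<lambda>n. \<bar>v n\<bar>)" using v by (simp add: l1_def)
  have smt: "summable (\<lambda>n. \<bar>tail N v n\<bar>)" for N
    by (rule summable_comparison_test'[OF sm, of 0]) (simp add: tail_def)
  show "tail N v \<in> l1" using smt by (simp add: l1_def)
  have eq: "l1_norm (tail N v) = l1_norm v - (\<Sum>n<N. \<bar>v n\<bar>)" for N
  proof -
    have "l1_norm (tail N v) = (\<Sum>n. \<bar>tail N v (n + N)\<bar>) + (\<Sum>n<N. \<bar>tail N v n\<bar>)"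
      unfolding l1_norm_def by (rule suminf_split_initial_segment[OF smt])
    also have "\<dots> = (\<Sum>n. \<bar>v (n + N)\<bar>)" by (simp add: tail_def)
    also have "\<dots> = l1_norm v - (\<Sum>n<N. \<bar>v n\<bar>)"
      unfolding l1_norm_def by (rule suminf_minus_initial_segment[OF sm])
    finally show ?thesis .
  qed
  have "(\<lambda>N. l1_norm v - (\<Sum>n<N. \<bar>v n\<bar>)) \<longlonglongrightarrow> l1_norm v - l1_norm v"
    unfolding l1_norm_def by (intro tendsto_intros summable_LIMSEQ sm)
  then show "(\<lambda>N. l1_norm (tail N v)) \<longlonglongrightarrow> 0" using eq by simp
qed

lemma l1_mult_bounded_summable:
  fixes v b :: "nat \<Rightarrow> real"
  assumes "v \<in> l1" "\<And>n. \<bar>b n\<bar> \<le> R"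
  shows "summable (\<lambda>n. v n * b n)" "summable (\<lambda>n. \<bar>v n * b n\<bar>)"
proof -
  have sm: "summable (\<lambda>n. \<bar>v n\<bar> * R)" using assms(1) by (auto simp: l1_def intro: summable_mult2)
  have "norm \<bar>v n * b n\<bar> \<le> \<bar>v n\<bar> * R" for n
    using assms(2) by (simp add: abs_mult mult_left_mono)
  then show "summable (\<lambda>n. \<bar>v n * b n\<bar>)" by (rule summable_comparison_test'[OF sm, of 0])
  then show "summable (\<lambda>n. v n * b n)" by (rule summable_rabs_cancel)
qed

text \<open>An operator on l1 is controlled by its columns: for each finite set of rows the two sums
  are interchanged and every column contributes at most \<open>R\<close>. It is applied to the large
  entries of the matrix of \<open>A\<close>.\<close>

lemma bounded_op_matrix_l1:
  fixes b :: "nat \<Rightarrow> nat \<Rightarrow> real"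
  assumes b: "\<And>n M. (\<Sum>i<M. \<bar>b n i\<bar>) \<le> R"
  shows "bounded_op l1 l1_norm l1 l1_norm (\<lambda>v i. \<Sum>n. v n * b n i)"
proof -
  have bR: "\<bar>b n i\<bar> \<le> R" for n i
  proof -
    have "\<bar>b n i\<bar> \<le> (\<Sum>i<Suc i. \<bar>b n i\<bar>)" by (rule member_le_sum) auto
    then show ?thesis using b[where n = n and M = "Suc i"] by linarith
  qed
  have part: "(\<Sum>i<M. \<bar>\<Sum>n. v n * b n i\<bar>) \<le> R * l1_norm v" if v: "v \<in> l1" for v M
  proof -
    note sm = l1_mult_bounded_summable[OF v bR]
    have smv: "summable (\<lambda>n. \<bar>v n\<bar>)" using v by (simp add: l1_def)
    have "(\<Sum>i<M. \<bar>\<Sum>n. v n * b n i\<bar>) \<le> (\<Sum>i<M. \<Sum>n. \<bar>v n * b n i\<bar>)"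
      by (intro sum_mono summable_rabs sm)
    also have "\<dots> = (\<Sum>n. \<Sum>i<M. \<bar>v n * b n i\<bar>)"
      by (rule suminf_sum[symmetric]) (rule sm)
    also have "\<dots> \<le> (\<Sum>n. R * \<bar>v n\<bar>)"
    proof (rule suminf_le)
      show "(\<Sum>i<M. \<bar>v n * b n i\<bar>) \<le> R * \<bar>v n\<bar>" for n
        using mult_left_mono[OF b[where M = M and n = n], of "\<bar>v n\<bar>"]
        by (simp add: abs_mult sum_distrib_left mult.commute)
    qed (intro summable_sum sm summable_mult smv)+
    also have "\<dots> = R * l1_norm v" unfolding l1_norm_def by (rule suminf_mult[OF smv])
    finally show ?thesis .
  qed
  show ?thesis
    unfolding bounded_op_def
  proof (intro conjI ballI allI exI[of _ R])
    fix v assume v: "v \<in> l1"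
    show "(\<lambda>i. \<Sum>n. v n * b n i) \<in> l1" "l1_norm (\<lambda>i. \<Sum>n. v n * b n i) \<le> R * l1_norm v"
      using l1_if_partial_sums_le[OF part[OF v]] by auto
    note sm = l1_mult_bounded_summable(1)[OF v bR]
    show "(\<lambda>i. \<Sum>n. c * v n * b n i) = (\<lambda>i. c * (\<Sum>n. v n * b n i))" for c
      using suminf_mult[OF sm] by (simp add: mult.assoc)
    fix u assume u: "u \<in> l1"
    show "(\<lambda>i. \<Sum>n. (v n + u n) * b n i) = (\<lambda>i. (\<Sum>n. v n * b n i) + (\<Sum>n. u n * b n i))"
      using suminf_add[OF sm l1_mult_bounded_summable(1)[OF u bR]] by (simp add: distrib_right)
  qed
qed

section \<open>Matrices of operators from l1 into the Lorentz space\<close>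

context lorentz_weight
begin

text \<open>Here the divergence of the weights enters: \<open>N\<close> entries of size at least
  \<open>\<tau>\<close> force the norm up to \<open>\<tau>\<close> times the sum of the first
  \<open>N\<close> weights, which exceeds \<open>L\<close> for a suitable \<open>N\<close>. So there
  are fewer than \<open>N\<close> such entries, each at most \<open>L\<close>. The resulting bound
  \<open>N * L\<close> is uniform, hence valid for all columns of an operator at once.\<close>

lemma large_entries_sum_le:
  assumes \<tau>: "0 < \<tau>"
  shows "\<exists>R. \<forall>x\<in>X. nm x \<le> L \<longrightarrow> (\<forall>M. (\<Sum>i<M. if \<tau> \<le> \<bar>x i\<bar> then \<bar>x i\<bar> else 0) \<le> R)"
proof -
  have "\<exists>N. L / \<tau> < (\<Sum>k<N. w k)"
  proof (rule ccontr)
    assume "\<not> ?thesis"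
    then have "\<And>N. (\<Sum>k<N. w k) \<le> L / \<tau>" by (auto simp: not_less)
    then have "summable w" using w_nonneg by (intro summableI_nonneg_bounded) auto
    then show False using w_not_summable by simp
  qed
  then obtain N where N: "L < \<tau> * (\<Sum>k<N. w k)" using \<tau> by (auto simp: field_simps)
  have "(\<Sum>i<M. if \<tau> \<le> \<bar>x i\<bar> then \<bar>x i\<bar> else 0) \<le> real N * L" if x: "x \<in> X" "nm x \<le> L" for x M
  proof -
    define G where "G = {i. i < M \<and> \<tau> \<le> \<bar>x i\<bar>}"
    have L: "0 \<le> L" using lorentz_nonneg[OF x(1)] x(2) by linarith
    have "card G < N"
    proof (rule ccontr)
      assume "\<not> card G < N"
      then obtain H where H: "H \<subseteq> G" "card H = N" "finite H"
        using obtain_subset_with_card_n[of N G] by (metis not_less)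
      obtain h where h: "bij_betw h {..<N} H"
        using ex_bij_betw_nat_finite[OF H(3)] H(2) by (auto simp: atLeast0LessThan)
      let ?P = "(\<lambda>n. (h n, n)) ` {..<N}"
      have P: "pinj ?P" using h by (auto simp: pinj_def inj_on_def bij_betw_def)
      have "\<tau> * (\<Sum>k<N. w k) \<le> (\<Sum>k<N. w k * \<bar>x (h k)\<bar>)"
        unfolding sum_distrib_left
      proof (rule sum_mono)
        fix k assume "k \<in> {..<N}"
        then have "h k \<in> G" using h H(1) by (auto simp: bij_betw_def)
        then have "w k * \<tau> \<le> w k * \<bar>x (h k)\<bar>"
          using w_nonneg by (intro mult_left_mono) (auto simp: G_def)
        then show "\<tau> * w k \<le> w k * \<bar>x (h k)\<bar>" by (simp add: mult.commute)
      qed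
      also have "\<dots> = psum w ?P x"
        unfolding psum_def by (subst sum.reindex) (auto simp: inj_on_def)
      also have "\<dots> \<le> nm x" by (rule psum_le_lorentz[OF x(1) P])
      finally show False using N x(2) by linarith
    qed
    have "(\<Sum>i<M. if \<tau> \<le> \<bar>x i\<bar> then \<bar>x i\<bar> else 0) = (\<Sum>i\<in>G. \<bar>x i\<bar>)"
      unfolding G_def by (rule sum.mono_neutral_cong_right) auto
    also have "\<dots> \<le> (\<Sum>i\<in>G. L)"
      using coord_le_lorentz[OF x(1)] x(2) by (intro sum_mono) (meson order_trans)
    also have "\<dots> \<le> real N * L" using \<open>card G < N\<close> L by (simp add: mult_right_mono)
    finally show ?thesis .
  qed
  then show ?thesis by blast
qed

text \<open>Truncations of \<open>v\<close> converge to \<open>v\<close> in l1 and coordinates are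
  continuous on the Lorentz space, so \<open>A\<close> is recovered row by row from its
  columns.\<close>

lemma bounded_op_l1_matrix:
  assumes A: "bounded_op l1 l1_norm X nm A" and v: "v \<in> l1"
  shows "(\<lambda>n. v n * A (unit_seq n) i) sums A v i"
proof -
  obtain L where L: "0 < L" "\<And>v. v \<in> l1 \<Longrightarrow> nm (A v) \<le> L * l1_norm v"
    using bounded_op_bound[OF A l1_norm_nonneg] by blast
  have *: "A v i - (\<Sum>n<N. v n * A (unit_seq n) i) = A (tail N v) i" for N
  proof -
    have trunc: "(\<lambda>k. \<Sum>n<N. v n * unit_seq n k) \<in> l1"
      by (rule lin_subspace_sum[OF lin_subspace_l1]) (auto intro: unit_seq_l1)
    have "v k - (\<Sum>n<N. v n * unit_seq n k) = tail N v k" for k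
    proof -
      have "(\<Sum>n<N. v n * unit_seq n k) = (\<Sum>n<N. if n = k then v n else 0)"
        by (intro sum.cong) (auto simp: unit_seq_def)
      then show ?thesis by (simp add: tail_def)
    qed
    then have "tail N v = (\<lambda>k. v k - (\<Sum>n<N. v n * unit_seq n k))" by simp
    then have "A (tail N v) = (\<lambda>k. A v k - A (\<lambda>k. \<Sum>n<N. v n * unit_seq n k) k)"
      using bounded_op_diff[OF A lin_subspace_l1 v trunc] by simp
    also have "A (\<lambda>k. \<Sum>n<N. v n * unit_seq n k) = (\<lambda>k. \<Sum>n<N. v n * A (unit_seq n) k)"
      by (rule bounded_op_sum[OF A lin_subspace_l1]) (auto intro: unit_seq_l1)
    finally show ?thesis by simp
  qed
  have bnd: "norm (A v i - (\<Sum>n<N. v n * A (unit_seq n) i)) \<le> L * l1_norm (tail N v)" for N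
  proof -
    have "\<bar>A (tail N v) i\<bar> \<le> nm (A (tail N v))"
      by (rule coord_le_lorentz[OF bounded_opD(1)[OF A l1_norm_tail_tendsto(1)[OF v]]])
    also have "\<dots> \<le> L * l1_norm (tail N v)" by (rule L(2)[OF l1_norm_tail_tendsto(1)[OF v]])
    finally show ?thesis unfolding * by simp
  qed
  have "(\<lambda>N. L * l1_norm (tail N v)) \<longlonglongrightarrow> 0"
    using tendsto_mult_right_zero[OF l1_norm_tail_tendsto(2)[OF v]] by simp
  then have "(\<lambda>N. A v i - (\<Sum>n<N. v n * A (unit_seq n) i)) \<longlonglongrightarrow> 0"
    by (rule Lim_null_comparison[rotated]) (use bnd in auto)
  then have "(\<lambda>N. A v i - (A v i - (\<Sum>n<N. v n * A (unit_seq n) i))) \<longlonglongrightarrow> A v i - 0"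
    by (intro tendsto_diff tendsto_const)
  then show ?thesis by (simp add: sums_def)
qed

end

theorem theorem6p12:
  fixes w :: "nat \<Rightarrow> real"
    and T A B :: "(nat \<Rightarrow> real) \<Rightarrow> (nat \<Rightarrow> real)"
  assumes "weight w"
    and "bounded_op (dw1 w) (lorentz_norm w) (dw1 w) (lorentz_norm w) T"
    and "strictly_singular (dw1 w) (lorentz_norm w) (lorentz_norm w) T"
    and "bounded_op l1 l1_norm (dw1 w) (lorentz_norm w) A"
    and "bounded_op (dw1 w) (lorentz_norm w) l1 l1_norm B"
    and "positive_op l1 A"
    and "positive_op (dw1 w) B"
    and "\<forall>x\<in>dw1 w. T x = A (B x)"
  shows "in_closure_Jj w T"
proof -
  interpret lorentz_weight w by unfold_locales (rule assms(1))
  note T = assms(2) and A = assms(4) and B = assms(5)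
  obtain L where L: "0 < L" "\<And>v. v \<in> l1 \<Longrightarrow> nm (A v) \<le> L * l1_norm v"
    using bounded_op_bound[OF A l1_norm_nonneg] by blast
  obtain \<beta> where \<beta>: "0 < \<beta>" "\<And>x. x \<in> X \<Longrightarrow> l1_norm (B x) \<le> \<beta> * nm x"
    using bounded_op_bound[OF B lorentz_nonneg] by blast
  have BX: "B x \<in> l1" if "x \<in> X" for x by (rule bounded_opD(1)[OF B that])
  define a where "a n = A (unit_seq n)" for n
  have aX: "a n \<in> X" and a_norm: "nm (a n) \<le> L" for n
    using bounded_opD(1)[OF A unit_seq_l1] L(2)[OF unit_seq_l1, of n]
    by (auto simp: a_def l1_norm_unit_seq)
  have a0: "0 \<le> a n i" for n i
    using assms(6) unit_seq_l1[of n] by (auto simp: positive_op_def a_def unit_seq_def)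
  have aL: "a n i \<le> L" for n i
    using coord_le_lorentz[OF aX, of n i] a_norm[of n] by linarith

  \<comment> \<open>The matrix of \<open>A\<close> split at a threshold\<close>
  define big where "big \<tau> n i = (if \<tau> \<le> a n i then a n i else 0)" for \<tau> n i
  define small where "small \<tau> n i = a n i - big \<tau> n i" for \<tau> n i
  have big_bnd: "\<bar>big \<tau> n i\<bar> \<le> L" for \<tau> n i using a0[of n i] aL[of n i] L(1) by (auto simp: big_def)
  have small0: "0 \<le> small \<tau> n i" for \<tau> n i using a0[of n i] by (auto simp: big_def small_def)
  have small_a: "small \<tau> n i \<le> a n i" for \<tau> n i using a0[of n i] by (auto simp: big_def small_def)
  have small_L: "\<bar>small \<tau> n i\<bar> \<le> L" for \<tau> n i
    using small0[of \<tau> n i] small_a[of \<tau> n i] aL[of n i] by linarith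
  have small_\<tau>: "small \<tau> n i \<le> \<tau>" if "0 < \<tau>" for \<tau> n i using that by (auto simp: big_def small_def)
  define S where "S \<tau> x = (\<lambda>i. \<Sum>n. B x n * big \<tau> n i)" for \<tau> x
  have S: "bounded_op X nm l1 l1_norm (S \<tau>)" if \<tau>: "0 < \<tau>" for \<tau>
  proof -
    obtain R where R: "\<And>x M. x \<in> X \<Longrightarrow> nm x \<le> L \<Longrightarrow>
        (\<Sum>i<M. if \<tau> \<le> \<bar>x i\<bar> then \<bar>x i\<bar> else 0) \<le> R"
      using large_entries_sum_le[OF \<tau>, of L] by blast
    have "(\<Sum>i<M. \<bar>big \<tau> n i\<bar>) \<le> R" for n M
    proof -
      have "(\<Sum>i<M. \<bar>big \<tau> n i\<bar>) = (\<Sum>i<M. if \<tau> \<le> \<bar>a n i\<bar> then \<bar>a n i\<bar> else 0)"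
        using a0 by (intro sum.cong) (auto simp: big_def)
      then show ?thesis using R[OF aX a_norm] by simp
    qed
    then show ?thesis
      unfolding S_def by (intro bounded_op_compose[OF B bounded_op_matrix_l1 l1_norm_nonneg])
  qed
  have id_op: "bounded_op X nm X nm (\<lambda>x. x)" by (auto simp: bounded_op_def intro: exI[of _ 1])
  \<comment> \<open>Since \<open>S \<tau>\<close> already takes its values in l1, it serves as the
    factor \<open>D\<close>, and the identity serves as \<open>C\<close>.\<close>
  have S_Jj: "in_Jj w (S \<tau>)" if "0 < \<tau>" for \<tau>
    unfolding in_Jj_def jid_def using id_op S[OF that] by blast
  define U where "U \<tau> x = (\<lambda>i. T x i - S \<tau> x i)" for \<tau> x
  have UX: "U \<tau> x \<in> X" if "0 < \<tau>" "x \<in> X" for \<tau> x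
    unfolding U_def
    by (intro lorentz_diff(1) bounded_opD(1)[OF T] l1_subset_dw1(1) bounded_opD(1)[OF S] that)
  have U_scale: "U \<tau> (\<lambda>n. c * x n) = (\<lambda>i. c * U \<tau> x i)" if "0 < \<tau>" "x \<in> X" for \<tau> c x
    unfolding U_def bounded_opD(3)[OF T that(2)] bounded_opD(3)[OF S[OF that(1)] that(2)]
    by (simp add: right_diff_distrib)
  have T_sums: "(\<lambda>n. B x n * a n i) sums T x i" if "x \<in> X" for x i
    using bounded_op_l1_matrix[OF A BX[OF that]] assms(8) that by (simp add: a_def)
  have sm_big: "summable (\<lambda>n. B x n * big \<tau> n i)" if "x \<in> X" for x \<tau> i
    by (rule l1_mult_bounded_summable(1)[OF BX[OF that] big_bnd])
  have sm_small: "summable (\<lambda>n. B x n * small \<tau> n i)" "summable (\<lambda>n. \<bar>B x n * small \<tau> n i\<bar>)"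
    if "x \<in> X" for x \<tau> i
    by (rule l1_mult_bounded_summable[OF BX[OF that] small_L])+
  have U_eq: "U \<tau> x i = (\<Sum>n. B x n * small \<tau> n i)" if "x \<in> X" for \<tau> x i
    using suminf_diff[OF sums_summable[OF T_sums[OF that]] sm_big[OF that], of i \<tau> i]
      sums_unique[OF T_sums[OF that], of i]
    by (simp add: U_def S_def small_def right_diff_distrib)
  have B_pos: "0 \<le> B x n" if "x \<in> X" "\<And>n. 0 \<le> x n" for x n
    using assms(7) that by (simp add: positive_op_def)
  \<comment> \<open>Apply positivity of \<open>B\<close> to the nonnegative vectors
    \<open>\<bar>x\<bar> + x\<close> and \<open>\<bar>x\<bar> - x\<close>.\<close>
  have B_abs: "\<bar>B x n\<bar> \<le> B (\<lambda>k. \<bar>x k\<bar>) n" if x: "x \<in> X" for x n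
  proof -
    note ax = lorentz_abs(1)[OF x]
    have "0 \<le> B (\<lambda>k. \<bar>x k\<bar> + x k) n" "0 \<le> B (\<lambda>k. \<bar>x k\<bar> - x k) n"
      by (auto intro!: B_pos lorentz_add(1) lorentz_diff(1) ax x)
    then show ?thesis
      using bounded_opD(2)[OF B ax x] bounded_op_diff[OF B lin_subspace_dw1 ax x] by simp
  qed
  show ?thesis
    unfolding in_closure_Jj_def
  proof (rule ccontr)

    \<comment> \<open>Contradiction if \<open>T\<close> stays at positive distance from the
      ideal\<close>
    assume "\<not> (\<forall>\<epsilon>>0. \<exists>S. in_Jj w S \<and> (\<forall>x\<in>X. nm (\<lambda>n. T x n - S x n) \<le> \<epsilon> * nm x))"
    then obtain \<epsilon> where \<epsilon>: "0 < \<epsilon>"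
      and far: "\<And>S. in_Jj w S \<Longrightarrow> \<exists>x\<in>X. \<epsilon> * nm x < nm (\<lambda>n. T x n - S x n)"
      by (meson not_le)
    \<comment> \<open>A bad vector is normalised and replaced by its absolute value. The small
      entries are nonnegative, so \<open>B_abs\<close> gives
      \<open>\<bar>U \<tau> u i\<bar> \<le> U \<tau> \<bar>u\<bar> i\<close>, and the norm of the
      image does not drop.\<close>
    have witness: "\<exists>x. x \<in> X \<and> nm x \<le> 1 \<and> (\<forall>n. 0 \<le> x n) \<and> \<epsilon> < nm (U \<tau> x)" if \<tau>: "0 < \<tau>" for \<tau>
    proof -
      obtain z where z: "z \<in> X" "\<epsilon> * nm z < nm (U \<tau> z)"
        using far[OF S_Jj[OF \<tau>]] unfolding U_def by blast
      have "nm z \<noteq> 0"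
      proof
        assume "nm z = 0"
        then have "z = (\<lambda>n. 0 * z n)" using coord_le_lorentz[OF z(1)] by auto
        then have "U \<tau> z = (\<lambda>i. 0 * U \<tau> z i)" using U_scale[OF \<tau> z(1), of 0] by simp
        then have "nm (U \<tau> z) = 0" using lorentz_zero by simp
        then show False using z(2) \<open>nm z = 0\<close> by simp
      qed
      then have pos: "0 < nm z" using lorentz_nonneg[OF z(1)] by simp
      define u where "u = (\<lambda>n. inverse (nm z) * z n)"
      have u: "u \<in> X" "nm u = 1"
        unfolding u_def using lorentz_scale_le(1)[OF z(1)] lorentz_scale[OF z(1)] pos by auto
      have "nm (U \<tau> u) = inverse (nm z) * nm (U \<tau> z)"
        unfolding u_def U_scale[OF \<tau> z(1)] using lorentz_scale[OF UX[OF \<tau> z(1)]] pos by simp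
      then have "nm z * nm (U \<tau> u) = nm (U \<tau> z)" using pos by (simp add: field_simps)
      then have "nm z * \<epsilon> < nm z * nm (U \<tau> u)" using z(2) by (simp add: mult.commute)
      then have Uu: "\<epsilon> < nm (U \<tau> u)" using pos by simp
      let ?x = "\<lambda>n. \<bar>u n\<bar>"
      note x = lorentz_abs[OF u(1)]
      have "\<bar>U \<tau> u i\<bar> \<le> U \<tau> ?x i" for i
      proof -
        have "\<bar>U \<tau> u i\<bar> \<le> (\<Sum>n. \<bar>B u n * small \<tau> n i\<bar>)"
          unfolding U_eq[OF u(1)] by (rule summable_rabs[OF sm_small(2)[OF u(1)]])
        also have "\<dots> \<le> U \<tau> ?x i"
          unfolding U_eq[OF x(1)]
        proof (rule suminf_le[OF _ sm_small(2)[OF u(1)] sm_small(1)[OF x(1)]])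
          show "\<bar>B u n * small \<tau> n i\<bar> \<le> B ?x n * small \<tau> n i" for n
            using mult_right_mono[OF B_abs[OF u(1)] small0] small0 by (simp add: abs_mult)
        qed
        finally show ?thesis .
      qed
      then have "nm (U \<tau> u) \<le> nm (U \<tau> ?x)"
        by (intro lorentz_mono(2) UX \<tau> x(1)) (meson abs_ge_self order_trans)
      then show ?thesis using Uu x u(2) by (intro exI[of _ ?x]) auto
    qed
    \<comment> \<open>Any positive sequence tending to 0 would do.\<close>
    define \<tau> where "\<tau> m = inverse (real (Suc m))" for m
    have \<tau>: "0 < \<tau> m" for m by (simp add: \<tau>_def)
    have "\<forall>m. \<exists>x. x \<in> X \<and> nm x \<le> 1 \<and> (\<forall>n. 0 \<le> x n) \<and> \<epsilon> < nm (U (\<tau> m) x)"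
      using witness \<tau> by blast
    then obtain x where x: "\<And>m. x m \<in> X" "\<And>m. nm (x m) \<le> 1" "\<And>m n. 0 \<le> x m n"
      "\<And>m. \<epsilon> < nm (U (\<tau> m) (x m))" by metis
    note Bx = B_pos[OF x(1) x(3)]
    have U0: "0 \<le> U (\<tau> m) (x m) i" for m i
      unfolding U_eq[OF x(1)] by (intro suminf_nonneg sm_small(1) x(1)) (simp add: Bx small0)
    \<comment> \<open>For nonnegative \<open>x m\<close> the series for \<open>T\<close> dominates
      that of its small part term by term; this makes \<open>U (\<tau> m) (x m)\<close> the required
      minorant.\<close>
    have UT: "U (\<tau> m) (x m) i \<le> T (x m) i" for m i
      unfolding U_eq[OF x(1)] sums_unique[OF T_sums[OF x(1)]]
      by (intro suminf_le mult_left_mono small_a Bx sm_small(1) x(1) sums_summable[OF T_sums])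
    \<comment> \<open>Nonnegativity turns the sum of the coefficients \<open>B (x m) n\<close> into
      the l1 norm of \<open>B (x m)\<close>, which is at most \<open>\<beta>\<close>.\<close>
    have U\<tau>: "U (\<tau> m) (x m) i \<le> \<beta> * \<tau> m" for m i
    proof -
      have smB: "summable (\<lambda>n. B (x m) n)" "(\<Sum>n. B (x m) n) = l1_norm (B (x m))"
        using BX[OF x(1)[of m]] Bx by (simp_all add: l1_def l1_norm_def)
      have "U (\<tau> m) (x m) i \<le> (\<Sum>n. B (x m) n * \<tau> m)"
        unfolding U_eq[OF x(1)]
        by (intro suminf_le mult_left_mono small_\<tau> \<tau> Bx sm_small(1) x(1) summable_mult2 smB(1))
      also have "\<dots> = l1_norm (B (x m)) * \<tau> m" using suminf_mult2[OF smB(1)] smB(2) by simp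
      also have "\<dots> \<le> \<beta> * \<tau> m"
      proof (rule mult_right_mono)
        have "l1_norm (B (x m)) \<le> \<beta> * nm (x m)" by (rule \<beta>(2)[OF x(1)])
        also have "\<dots> \<le> \<beta> * 1" using x(2) \<beta>(1) by (intro mult_left_mono) auto
        finally show "l1_norm (B (x m)) \<le> \<beta>" by simp
      qed (use \<tau>[of m] in simp)
      finally show ?thesis .
    qed
    have absU: "\<bar>U (\<tau> m) (x m) i\<bar> \<le> \<bar>T (x m) i\<bar>" "\<bar>U (\<tau> m) (x m) i\<bar> \<le> \<beta> * \<tau> m" for m i
      using U0[of m i] UT[of m i] U\<tau>[of m i] by linarith+
    have "(\<lambda>m. \<beta> * \<tau> m) \<longlonglongrightarrow> 0"
      unfolding \<tau>_def using tendsto_mult_right_zero[OF LIMSEQ_inverse_real_of_nat] .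
    then have "\<not> strictly_singular X nm nm T"
      by (intro flat_minorants_not_strictly_singular[OF T x(1) x(2) UX[OF \<tau> x(1)] absU(1) \<epsilon> x(4) absU(2)])
    then show False using assms(3) by simp
  qed
qed

end
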